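(* Let $(M_n)_{n\ge1}$, $M_n=(f_n(m,k))_{1\le m,k\le 2n}$, be the Delta sequence, and for $n\ge1$ let $\mathfrak T_{2n+1}$ be the set of strictly ordered binary trees on $2n+1$ vertices. Then for all $n\ge 1$ and all $1\le m,k\le 2n$, $$\#\{t\in\mathfrak T_{2n+1}:\ \mathrm{eoc}(t)=m,\ \mathrm{pom}(t)=k\}=f_n(m,k).$$
   Context: Delta sequence. For $n\ge1$, $M_n=(f_n(m,k))_{1\le m,k\le 2n}$ is a $2n\times 2n$ matrix; by convention $f_n(m,k)=0$ if $(m,k)\notin[1,2n]^2$. Write $f_n(m,\bullet)=\sum_{k=1}^{2n}f_n(m,k)$ and $f_n(\bullet,k)=\sum_{m=1}^{2n}f_n(m,k)$. Let $L_n^{(1)}=\{(m,k):2\le k+1\le m\le 2n-2\}$ and $U_n^{(1)}=\{(m,k):2\le m+1\le k\le 2n-2\}$. The Delta sequence is the unique sequence $(M_n)_{n\ge1}$ of matrices with nonnegative integer entries such that $M_1=\begin{pmatrix}0&0\\1&0\end{pmatrix}$ and, for every $n\ge2$: (a) $f_n(m,m)=0$ for all $m$; (b) $f_n(m+2,k)-2f_n(m+1,k)+f_n(m,k)+2f_{n-1}(m,k)=0$ for $(m,k)\in L_n^{(1)}$; (c) $f_n(m,k+2)-2f_n(m,k+1)+f_n(m,k)+2f_{n-1}(m,k)=0$ for $(m,k)\in U_n^{(1)}$; (d) column $2n$ of $M_n$ is zero, and column $2n-1$ is $(f_{n-1}(1,\bullet),\dots,f_{n-1}(2n-2,\bullet),0,0)$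 read top to bottom; (e) row $2n$ of $M_n$ is $(f_{n-1}(1,\bullet),\dots,f_{n-1}(2n-2,\bullet),0,0)$ read left to right, and row $2n-1$ is $(f_{n-1}(1,\bullet)+f_{n-1}(\bullet,1),\dots,f_{n-1}(2n-2,\bullet)+f_{n-1}(\bullet,2n-2),0,0)$. (These conditions determine the sequence uniquely.) Trees. A strictly ordered binary tree on $N$ vertices is a rooted tree whose vertices are labeled bijectively by $1,\dots,N$, the root being labeled $1$, in which every vertex has either no child (a leaf) or exactly two children (their order is immaterial), and labels increase along every path from the root. Such $N$ is odd; $\mathfrak T_{2n+1}$ denotes the set of these trees on $2n+1$ vertices. For $t\in\mathfrak T_{2n+1}$ ($n\ge1$): the minimal chain starts at the root and repeatedly moves to the child with the smaller label until a leaf is reached; $\mathrm{eoc}(t)$ is the label of that leaf. The vertex $2n+1$ is a leaf, and $\mathrm{pom}(t)$ is the label of its parent. *)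

theory Defs
  imports Main
begin

text \<open>A sequence of matrices \<open>M\<^sub>n = (f\<^sub>n(m,k))\<close>, with \<open>1 \<le> m, k \<le> 2n\<close>, is a function \<open>f\<close> with
  \<open>f n m k\<close> for \<open>f\<^sub>n(m,k)\<close>.\<close>

definition row_sum :: "(nat \<Rightarrow> nat \<Rightarrow> nat \<Rightarrow> nat) \<Rightarrow> nat \<Rightarrow> nat \<Rightarrow> nat" where
  "row_sum f n m = (\<Sum>k = 1..2*n. f n m k)"

definition col_sum :: "(nat \<Rightarrow> nat \<Rightarrow> nat \<Rightarrow> nat) \<Rightarrow> nat \<Rightarrow> nat \<Rightarrow> nat" where
  "col_sum f n k = (\<Sum>m = 1..2*n. f n m k)"

definition L1 :: "nat \<Rightarrow> (nat \<times> nat) set" where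
  "L1 n = {(m, k). 2 \<le> k + 1 \<and> k + 1 \<le> m \<and> m \<le> 2*n - 2}"

definition U1 :: "nat \<Rightarrow> (nat \<times> nat) set" where
  "U1 n = {(m, k). 2 \<le> m + 1 \<and> m + 1 \<le> k \<and> k \<le> 2*n - 2}"

text \<open>The first clause is the convention that entries outside the matrix vanish. For \<open>n = 0\<close> it
  gives \<open>f 0 = 0\<close>, so the unused index \<open>0\<close> does not spoil uniqueness.\<close>

definition delta_conditions :: "(nat \<Rightarrow> nat \<Rightarrow> nat \<Rightarrow> nat) \<Rightarrow> bool" where
  "delta_conditions f \<longleftrightarrow>
     (\<forall>n m k. (m, k) \<notin> {1..2*n} \<times> {1..2*n} \<longrightarrow> f n m k = 0) \<and>
     f 1 1 1 = 0 \<and> f 1 1 2 = 0 \<and> f 1 2 1 = 1 \<and> f 1 2 2 = 0 \<and>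
     (\<forall>n\<ge>2.
        (\<forall>m\<in>{1..2*n}. f n m m = 0) \<and>
        (\<forall>(m, k)\<in>L1 n. int (f n (m+2) k) - 2 * int (f n (m+1) k) + int (f n m k)
                          + 2 * int (f (n-1) m k) = 0) \<and>
        (\<forall>(m, k)\<in>U1 n. int (f n m (k+2)) - 2 * int (f n m (k+1)) + int (f n m k)
                          + 2 * int (f (n-1) m k) = 0) \<and>
        (\<forall>m\<in>{1..2*n}. f n m (2*n) = 0) \<and>
        (\<forall>m\<in>{1..2*n-2}. f n m (2*n-1) = row_sum f (n-1) m) \<and>
        f n (2*n-1) (2*n-1) = 0 \<and> f n (2*n) (2*n-1) = 0 \<and>
        (\<forall>k\<in>{1..2*n-2}. f n (2*n) k = row_sum f (n-1) k) \<and>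
        f n (2*n) (2*n-1) = 0 \<and> f n (2*n) (2*n) = 0 \<and>
        (\<forall>k\<in>{1..2*n-2}. f n (2*n-1) k = row_sum f (n-1) k + col_sum f (n-1) k) \<and>
        f n (2*n-1) (2*n-1) = 0 \<and> f n (2*n-1) (2*n) = 0)"

definition Delta :: "nat \<Rightarrow> nat \<Rightarrow> nat \<Rightarrow> nat" where
  "Delta = (THE f. delta_conditions f)"

text \<open>A rooted tree is given by its set \<open>E\<close> of pairs (parent, child). Labelled vertices are
  identified with their labels, and \<open>E `` {v}\<close> is the set of children of \<open>v\<close>.\<close>

definition rooted_tree :: "'a set \<Rightarrow> 'a \<Rightarrow> ('a \<times> 'a) set \<Rightarrow> bool" where
  "rooted_tree V r E \<longleftrightarrow>
     r \<in> V \<and> E \<subseteq> V \<times> V \<and>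
     (\<forall>u. (u, r) \<notin> E) \<and>
     (\<forall>v\<in>V - {r}. \<exists>!u. (u, v) \<in> E) \<and>
     (\<forall>v\<in>V. (r, v) \<in> E\<^sup>*)"

definition strictly_ordered_binary_trees :: "nat \<Rightarrow> (nat \<times> nat) set set" where
  "strictly_ordered_binary_trees N =
     {E. rooted_tree {1..N} 1 E \<and>
         (\<forall>v\<in>{1..N}. card (E `` {v}) = 0 \<or> card (E `` {v}) = 2) \<and>
         (\<forall>(u, v)\<in>E. u < v)}"

definition min_child_step :: "(nat \<times> nat) set \<Rightarrow> (nat \<times> nat) set" where
  "min_child_step E = {(v, c). E `` {v} \<noteq> {} \<and> c = Min (E `` {v})}"

definition eoc :: "(nat \<times> nat) set \<Rightarrow> nat" where
  "eoc E = (THE l. (1, l) \<in> (min_child_step E)\<^sup>* \<and> E `` {l} = {})"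

text \<open>\<open>pom n E\<close> is meant for trees \<open>E\<close> on \<open>2n + 1\<close> vertices.\<close>

definition pom :: "nat \<Rightarrow> (nat \<times> nat) set \<Rightarrow> nat" where
  "pom n E = (THE p. (p, 2*n+1) \<in> E)"

end

theory Submission
  imports Defs "HOL-Combinatorics.Transposition"
begin

text \<open>An increasing tree is determined by its parent map \<open>p\<close>, whose fibres have size 0 or 2; the
  end \<open>e\<close> of the minimal chain among the labels below \<open>s\<close> is computed by recursion on \<open>s\<close>, and
  \<open>eoc = m\<close> means that \<open>m\<close> is a leaf hung at the chain end of the labels below \<open>m\<close>. All bijections
  have the form \<open>p \<mapsto> \<sigma> \<circ> p \<circ> \<tau>\<close> for permutations \<open>\<sigma>\<close>, \<open>\<tau>\<close> of the labels, which preserves the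
  fibre sizes, so that only \<open>p v < v\<close> has to be rechecked. In the lower triangle, exchanging the
  labels \<open>m\<close> and \<open>m + 1\<close> reduces the first difference in \<open>m\<close> to the trees where \<open>m\<close> and
  \<open>m + 1\<close> are siblings or parent and child; rotating the labels \<open>m, m + 1, m + 2\<close> reduces the second
  difference to trees in which these three labels are adjacent, and regrafting the subtrees hung at
  them cancels everything but two copies of the trees in which \<open>m\<close> carries the two leaves \<open>m + 1\<close>
  and \<open>m + 2\<close>. Deleting these leaves gives the matrix of the previous order. The upper triangle
  is treated in the same way with \<open>k\<close> in place of \<open>m\<close>, and the border rows and columns come from
  deleting the two largest labels. Since the conditions determine the matrices, the theorem follows.\<close>

section \<open>Parent maps and the minimal chain\<close>

text \<open>The value 0 stands for "no parent". Prescribing it outside \<open>{2..N}\<close> makes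
  the map of a tree unique, so trees can be counted as functions; the fibre of 0 is not a set of
  children, hence \<open>u \<ge> 1\<close>.\<close>

definition parent_maps :: "nat \<Rightarrow> (nat \<Rightarrow> nat) set" where
  "parent_maps N = {p. (\<forall>v. v \<notin> {2..N} \<longrightarrow> p v = 0) \<and>
     (\<forall>v\<in>{2..N}. 1 \<le> p v \<and> p v < v) \<and>
     (\<forall>u\<ge>1. card {v. p v = u} = 0 \<or> card {v. p v = u} = 2)}"

text \<open>\<open>chain_end p s\<close> is the end of the minimal chain of the tree restricted to the labels below \<open>s\<close>:
  a new label \<open>s\<close> prolongs the chain iff it is the first child of the current end.\<close>

primrec chain_end :: "(nat \<Rightarrow> nat) \<Rightarrow> nat \<Rightarrow> nat" where
  "chain_end p 0 = 1"
| "chain_end p (Suc s) = (if p s = chain_end p s then s else chain_end p s)"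

lemma parent_maps_outside: "p \<in> parent_maps N \<Longrightarrow> v \<notin> {2..N} \<Longrightarrow> p v = 0"
  by (auto simp: parent_maps_def)

lemma parent_maps_inside: "p \<in> parent_maps N \<Longrightarrow> v \<in> {2..N} \<Longrightarrow> 1 \<le> p v \<and> p v < v"
  unfolding parent_maps_def by blast

lemma parent_maps_less: "p \<in> parent_maps N \<Longrightarrow> p v \<noteq> 0 \<Longrightarrow> p v < v \<and> 2 \<le> v \<and> v \<le> N"
  using parent_maps_outside[of p N v] parent_maps_inside[of p N v] by fastforce

lemma finite_fibre:
  assumes "p \<in> parent_maps N" "u \<ge> 1"
  shows "finite {v. p v = u}"
proof -
  have "{v. p v = u} \<subseteq> {2..N}" using assms parent_maps_less[of p N] by fastforce
  then show ?thesis using finite_subset by blast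
qed

lemma card_fibre:
  assumes "p \<in> parent_maps N" "u \<ge> 1" "p a = u"
  shows "card {v. p v = u} = 2"
proof -
  have "card {v. p v = u} \<noteq> 0" using finite_fibre[OF assms(1,2)] assms(3) by auto
  moreover have "\<forall>u\<ge>1. card {v. p v = u} = 0 \<or> card {v. p v = u} = 2"
    using assms(1) unfolding parent_maps_def by blast
  ultimately show ?thesis using assms(2) by (metis (no_types, lifting))
qed

lemma sibling_exists:
  assumes "p \<in> parent_maps N" "p a \<noteq> 0"
  obtains b where "b \<noteq> a" "{v. p v = p a} = {a, b}"
proof -
  have "card {v. p v = p a} = 2" using card_fibre[OF assms(1), of "p a" a] assms(2) by simp
  then obtain x y where "{v. p v = p a} = {x, y}" "x \<noteq> y" by (auto simp: card_2_iff)
  moreover have "a \<in> {v. p v = p a}" by simp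
  ultimately show thesis using that by (metis insert_iff insert_commute singletonD)
qed

lemma no_third_child:
  assumes "p \<in> parent_maps N" "p a \<noteq> 0" "p b = p a" "b \<noteq> a" "p c = p a"
  shows "c = a \<or> c = b"
proof -
  obtain d where "{v. p v = p a} = {a, d}" using sibling_exists[OF assms(1,2)] by metis
  then show ?thesis using assms by blast
qed

lemma finite_parent_maps: "finite (parent_maps N)"
proof (rule finite_subset)
  show "parent_maps N \<subseteq> {p. \<forall>v. (v \<in> {2..N} \<longrightarrow> p v \<in> {..N}) \<and> (v \<notin> {2..N} \<longrightarrow> p v = 0)}"
    using parent_maps_inside parent_maps_outside by fastforce
  show "finite {p. \<forall>v. (v \<in> {2..N} \<longrightarrow> p v \<in> {..N}) \<and> (v \<notin> {2..N} \<longrightarrow> p v = (0::nat))}"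
    by (rule finite_set_of_finite_funs) auto
qed

lemma chain_end_pos:
  assumes "p \<in> parent_maps N"
  shows "chain_end p s \<ge> 1"
proof (induction s)
  case (Suc s)
  have "p 0 = 0" using parent_maps_outside[OF assms] by simp
  then show ?case using Suc by (cases "s = 0") auto
qed simp

lemma chain_end_less:
  assumes "p \<in> parent_maps N" "s \<ge> 2"
  shows "chain_end p s < s"
  using assms(2)
proof (induction s rule: dec_induct)
  case base
  have "p 0 = 0" "p 1 = 0" using parent_maps_outside[OF assms(1)] by simp_all
  then show ?case by (simp add: numeral_2_eq_2)
qed auto

text \<open>A label that becomes the new end has only larger children, and an end that survives the
  label \<open>s\<close> does not have \<open>s\<close> as a child.\<close>

lemma chain_end_childless:
  assumes "p \<in> parent_maps N" "v < s"
  shows "p v \<noteq> chain_end p s"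
  using assms(2)
proof (induction s)
  case (Suc s)
  have pos: "chain_end p (Suc s) \<noteq> 0" using chain_end_pos[OF assms(1), of "Suc s"] by simp
  show ?case
  proof (cases "p s = chain_end p s")
    case True
    then show ?thesis using Suc.prems parent_maps_less[OF assms(1), of v] pos by auto
  next
    case False
    then show ?thesis using Suc by (cases "v = s") auto
  qed
qed simp

lemma chain_end_cong: "(\<And>v. v < s \<Longrightarrow> p v = q v) \<Longrightarrow> chain_end p s = chain_end q s"
  by (induction s) auto

text \<open>A label becomes the end only at the moment of its insertion and loses this role with its
  first child. The label 1 is excluded, being the end from the start without hanging
  anywhere.\<close>

lemma chain_end_eq_iff:
  assumes "p \<in> parent_maps N" "s \<ge> 2" "m \<noteq> 1"
  shows "chain_end p s = m \<longleftrightarrow> m < s \<and> p m = chain_end p m \<and> (\<forall>v<s. p v \<noteq> m)"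
  using assms(2)
proof (induction s rule: dec_induct)
  case base
  have "p 0 = 0" "p 1 = 0" using parent_maps_outside[OF assms(1)] by simp_all
  then show ?case using assms(3) by (auto simp: numeral_2_eq_2 less_Suc_eq)
next
  case (step s)
  show ?case
  proof (cases "p s = chain_end p s")
    case True
    then have "chain_end p (Suc s) = s" by simp
    moreover have "p v \<noteq> s" if "v < Suc s" for v
      using that parent_maps_less[OF assms(1), of v] step by (cases "p v = 0") auto
    ultimately show ?thesis using True step by (auto simp: less_Suc_eq)
  next
    case False
    then show ?thesis using step by (auto simp: less_Suc_eq)
  qed
qed

text \<open>This makes the end of the whole chain a condition on the chain below \<open>m\<close>
  and on the children of \<open>m\<close>, which survives moves of larger labels. For
  \<open>m = 1\<close> both sides fail, since 2 is a child of 1.\<close>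

lemma chain_end_total:
  assumes "p \<in> parent_maps N" "N \<ge> 2"
  shows "chain_end p (Suc N) = m \<longleftrightarrow> p m = chain_end p m \<and> (\<forall>v. p v \<noteq> m)"
proof (cases "m = 1")
  case True
  have "p 2 = 1" "p 1 = 0" using parent_maps_inside[OF assms(1), of 2] assms(2)
      parent_maps_outside[OF assms(1)] by auto
  then show ?thesis using chain_end_childless[OF assms(1), of 2 "Suc N"] assms(2) True by auto
next
  case False
  have "m < Suc N \<and> (\<forall>v. p v \<noteq> m)" if "p m = chain_end p m" "\<forall>v<Suc N. p v \<noteq> m"
  proof -
    have "p m \<noteq> 0" using chain_end_pos[OF assms(1), of m] that by simp
    then have "m \<le> N" "m \<noteq> 0" using parent_maps_less[OF assms(1), of m] by auto
    then show ?thesis using that(2) parent_maps_outside[OF assms(1)]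
      by (metis atLeastAtMost_iff less_Suc_eq_le)
  qed
  moreover have "m < Suc N" if "p m = chain_end p m"
    using that chain_end_pos[OF assms(1), of m] parent_maps_less[OF assms(1), of m] by fastforce
  ultimately show ?thesis using chain_end_eq_iff[OF assms(1) _ False, of "Suc N"] assms(2) by auto
qed

section \<open>Counting parent maps\<close>

definition count :: "nat \<Rightarrow> ((nat \<Rightarrow> nat) \<Rightarrow> bool) \<Rightarrow> nat" where
  "count N P = card {p \<in> parent_maps N. P p}"

lemma count_cong: "(\<And>p. p \<in> parent_maps N \<Longrightarrow> P p \<longleftrightarrow> Q p) \<Longrightarrow> count N P = count N Q"
  unfolding count_def by (metis (mono_tags, lifting) Collect_cong)

lemma count_split: "count N P = count N (\<lambda>p. P p \<and> R p) + count N (\<lambda>p. P p \<and> \<not> R p)"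
proof -
  have "{p \<in> parent_maps N. P p} = {p \<in> parent_maps N. P p \<and> R p} \<union> {p \<in> parent_maps N. P p \<and> \<not> R p}"
    by auto
  then show ?thesis unfolding count_def
    by (simp add: card_Un_disjoint finite_parent_maps disjoint_iff)
qed

lemma count_eq_0: "(\<And>p. p \<in> parent_maps N \<Longrightarrow> \<not> P p) \<Longrightarrow> count N P = 0"
  unfolding count_def using finite_parent_maps by simp

text \<open>Double counting of pairs \<open>(i, p)\<close>: with \<open>r = 1\<close> it sums over
  the values of a statistic, with \<open>r = 2\<close> over the two children of a vertex.\<close>

lemma sum_count_indexed:
  assumes "finite I" "\<And>p. p \<in> parent_maps N \<Longrightarrow> P p \<Longrightarrow> card {i \<in> I. R i p} = r"
  shows "(\<Sum>i\<in>I. count N (\<lambda>p. P p \<and> R i p)) = r * count N P"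
proof -
  have "(\<Sum>i\<in>I. card {p \<in> {p \<in> parent_maps N. P p}. R i p}) = r * card {p \<in> parent_maps N. P p}"
    by (rule sum_multicount) (use assms finite_parent_maps in auto)
  moreover have "{p \<in> {p \<in> parent_maps N. P p}. R i p} = {p \<in> parent_maps N. P p \<and> R i p}" for i
    by auto
  ultimately show ?thesis unfolding count_def by simp
qed

text \<open>The permutations fix all labels below \<open>s\<close>, so the minimal chain up to there is unaffected.\<close>

lemma count_transform:
  fixes \<sigma> \<sigma>' \<tau> \<tau>' :: "nat \<Rightarrow> nat"
  assumes inv: "\<And>x. \<sigma>' (\<sigma> x) = x" "\<And>x. \<sigma> (\<sigma>' x) = x" "\<And>x. \<tau>' (\<tau> x) = x" "\<And>x. \<tau> (\<tau>' x) = x"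
    and fixed: "\<And>x. x < s \<Longrightarrow> \<sigma> x = x \<and> \<tau> x = x" and "s \<ge> 1"
    and dom: "\<And>v. \<tau> v \<in> {2..N} \<longleftrightarrow> v \<in> {2..N}"
    and P_less: "\<And>p w. p \<in> parent_maps N \<Longrightarrow> P p \<Longrightarrow> 2 \<le> w \<Longrightarrow> w \<le> N \<Longrightarrow> p w < w \<Longrightarrow> \<sigma> (p w) < \<tau>' w"
    and Q_less: "\<And>p w. p \<in> parent_maps N \<Longrightarrow> Q p \<Longrightarrow> 2 \<le> w \<Longrightarrow> w \<le> N \<Longrightarrow> p w < w \<Longrightarrow> \<sigma>' (p w) < \<tau> w"
    and fwd: "\<And>p q. p \<in> parent_maps N \<Longrightarrow> P p \<Longrightarrow> (\<And>v. q v = \<sigma> (p (\<tau> v))) \<Longrightarrow>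
        (\<And>r. r \<le> s \<Longrightarrow> chain_end q r = chain_end p r) \<Longrightarrow> Q q"
    and bwd: "\<And>p q. q \<in> parent_maps N \<Longrightarrow> Q q \<Longrightarrow> (\<And>v. p v = \<sigma>' (q (\<tau>' v))) \<Longrightarrow>
        (\<And>r. r \<le> s \<Longrightarrow> chain_end p r = chain_end q r) \<Longrightarrow> P p"
  shows "count N P = count N Q"
proof -
  \<comment> \<open>Labels below \<open>s\<close> have parents below \<open>s\<close>, so the new
    map agrees with \<open>p\<close> there.\<close>
  have chain: "chain_end (\<lambda>v. f (p (g v))) r = chain_end p r"
    if "p \<in> parent_maps N" "\<And>x. x < s \<Longrightarrow> f x = x \<and> g x = x" "r \<le> s" for f g p r
  proof (rule chain_end_cong)
    fix v assume "v < r"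
    moreover from this have "p v < s" using that(3) parent_maps_less[OF that(1), of v]
      by (cases "p v = 0") auto
    ultimately show "f (p (g v)) = p v" using that(2,3) by simp
  qed
  \<comment> \<open>Putting \<open>w = g v\<close> turns \<open>f (p (g v)) < v\<close> into
    \<open>f (p w) < g' w\<close>. The new fibre over \<open>u\<close> is the
    \<open>g'\<close>-image of the fibre of \<open>p\<close> over \<open>f' u\<close>, so its size
    is still 0 or 2.\<close>
  have valid: "(\<lambda>v. f (p (g v))) \<in> parent_maps N"
    if p: "p \<in> parent_maps N" and less: "\<forall>w\<in>{2..N}. f (p w) < g' w"
      and i: "\<And>x. f' (f x) = x" "\<And>x. f (f' x) = x" "\<And>x. g' (g x) = x" "\<And>x. g (g' x) = x"
      and f0: "f 0 = 0" and d: "\<And>v. g v \<in> {2..N} \<longleftrightarrow> v \<in> {2..N}" for f f' g g' p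
  proof -
    have f'0: "f' x = 0 \<longleftrightarrow> x = 0" for x using i f0 by metis
    have "f (p (g v)) = 0" if "v \<notin> {2..N}" for v
      using d[of v] parent_maps_outside[OF p, of "g v"] that f0 by metis
    moreover have "1 \<le> f (p (g v)) \<and> f (p (g v)) < v" if "v \<in> {2..N}" for v
    proof -
      have "g v \<in> {2..N}" using that d by blast
      then have "p (g v) \<noteq> 0" "f (p (g v)) < g' (g v)"
        using parent_maps_inside[OF p, of "g v"] less by auto
      moreover from this have "f (p (g v)) \<noteq> 0" using i(1) f'0 by metis
      ultimately show ?thesis using i(3) by simp
    qed
    moreover have "card {v. f (p (g v)) = u} = 0 \<or> card {v. f (p (g v)) = u} = 2" if "u \<ge> 1" for u
    proof -
      have "f x = u \<longleftrightarrow> x = f' u" for x using i(1,2) by metis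
      then have "{v. f (p (g v)) = u} = g' ` {v. p v = f' u}"
        using i(3,4) by (fastforce intro!: image_eqI[of _ g' "g _"])
      moreover have "inj_on g' A" for A using i(4) by (metis inj_on_inverseI)
      ultimately have "card {v. f (p (g v)) = u} = card {v. p v = f' u}"
        using card_image by metis
      moreover have "f' u \<ge> 1" using f'0[of u] that by simp
      moreover have "\<forall>u\<ge>1. card {v. p v = u} = 0 \<or> card {v. p v = u} = 2"
        using p unfolding parent_maps_def by blast
      ultimately show ?thesis by metis
    qed
    ultimately show ?thesis unfolding parent_maps_def by blast
  qed
  have fixed': "\<sigma>' x = x \<and> \<tau>' x = x" if "x < s" for x using fixed that inv by metis
  have dom': "\<tau>' v \<in> {2..N} \<longleftrightarrow> v \<in> {2..N}" for v using dom[of "\<tau>' v"] inv(4) by simp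
  have z: "\<sigma> 0 = 0" "\<sigma>' 0 = 0" using fixed fixed' \<open>s \<ge> 1\<close> by auto
  show ?thesis
    unfolding count_def
  proof (rule bij_betw_same_card[of "\<lambda>p v. \<sigma> (p (\<tau> v))"], rule bij_betw_byWitness[of _ "\<lambda>p v. \<sigma>' (p (\<tau>' v))"])
    show "(\<lambda>p v. \<sigma> (p (\<tau> v))) ` {p \<in> parent_maps N. P p} \<subseteq> {p \<in> parent_maps N. Q p}"
    proof clarify
      fix p assume p: "p \<in> parent_maps N" "P p"
      have "Q (\<lambda>v. \<sigma> (p (\<tau> v)))" by (rule fwd[OF p]) (simp_all add: chain[OF p(1) fixed])
      moreover have "\<forall>w\<in>{2..N}. \<sigma> (p w) < \<tau>' w"
        using P_less[OF p] parent_maps_inside[OF p(1)] by simp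
      ultimately show "(\<lambda>v. \<sigma> (p (\<tau> v))) \<in> parent_maps N \<and> Q (\<lambda>v. \<sigma> (p (\<tau> v)))"
        using valid[OF p(1) _ inv z(1) dom] by blast
    qed
    show "(\<lambda>p v. \<sigma>' (p (\<tau>' v))) ` {p \<in> parent_maps N. Q p} \<subseteq> {p \<in> parent_maps N. P p}"
    proof clarify
      fix p assume p: "p \<in> parent_maps N" "Q p"
      have "P (\<lambda>v. \<sigma>' (p (\<tau>' v)))" by (rule bwd[OF p]) (simp_all add: chain[OF p(1) fixed'])
      moreover have "\<forall>w\<in>{2..N}. \<sigma>' (p w) < \<tau> w"
        using Q_less[OF p] parent_maps_inside[OF p(1)] by simp
      ultimately show "(\<lambda>v. \<sigma>' (p (\<tau>' v))) \<in> parent_maps N \<and> P (\<lambda>v. \<sigma>' (p (\<tau>' v)))"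
        using valid[OF p(1) _ inv(2,1,4,3) z(2) dom'] by blast
    qed
  qed (simp_all add: inv)
qed

text \<open>Deleting the two top labels, both children of \<open>h p\<close>, leaves a tree in which
  that vertex is a leaf; adding them back is the inverse. As \<open>h\<close> and \<open>R\<close>
  look only at labels up to \<open>N\<close>, the deletion does not change them.\<close>

lemma count_insert_top:
  assumes local: "\<And>p q. (\<And>v. v \<le> N \<Longrightarrow> p v = q v) \<Longrightarrow> h p = h q \<and> (R p \<longleftrightarrow> R q)"
    and h: "\<And>q. q \<in> parent_maps N \<Longrightarrow> R q \<Longrightarrow> 1 \<le> h q \<and> h q \<le> N" and "N \<ge> 1"
  shows "count (N + 2) (\<lambda>p. p (N + 1) = h p \<and> p (N + 2) = h p \<and> R p) =
    count N (\<lambda>q. (\<forall>v. q v \<noteq> h q) \<and> R q)"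
  unfolding count_def
proof (rule bij_betw_same_card[of "\<lambda>p. p(N + 1 := 0, N + 2 := 0)"],
    rule bij_betw_byWitness[of _ "\<lambda>q. q(N + 1 := h q, N + 2 := h q)"])
  let ?P = "{p \<in> parent_maps (N + 2). p (N + 1) = h p \<and> p (N + 2) = h p \<and> R p}"
  let ?Q = "{q \<in> parent_maps N. (\<forall>v. q v \<noteq> h q) \<and> R q}"
  have up: "h (q(N + 1 := a, N + 2 := b)) = h q" "R (q(N + 1 := a, N + 2 := b)) \<longleftrightarrow> R q" for q a b
    using local[of "q(N + 1 := a, N + 2 := b)" q] by auto
  show "\<forall>p\<in>?P. (p(N + 1 := 0, N + 2 := 0))(N + 1 := h (p(N + 1 := 0, N + 2 := 0)), N + 2 := h (p(N + 1 := 0, N + 2 := 0))) = p"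
    using up(1) by (simp add: fun_eq_iff)
  show "\<forall>q\<in>?Q. (q(N + 1 := h q, N + 2 := h q))(N + 1 := 0, N + 2 := 0) = q"
    using parent_maps_outside[of _ N "N + 1"] parent_maps_outside[of _ N "N + 2"]
    by (auto simp: fun_eq_iff)
  show "(\<lambda>p. p(N + 1 := 0, N + 2 := 0)) ` ?P \<subseteq> ?Q"
  proof clarify
    fix p assume p: "p \<in> parent_maps (N + 2)" and e: "p (N + 1) = h p" "p (N + 2) = h p" and R: "R p"
    let ?q = "p(N + 1 := 0, N + 2 := 0)"
    have h1: "1 \<le> h p" using e(1) parent_maps_inside[OF p, of "N + 1"] \<open>N \<ge> 1\<close> by auto
    \<comment> \<open>The vertex \<open>h p\<close> has no room for further children, so the
      deletion makes it a leaf.\<close>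
    have only: "v = N + 1 \<or> v = N + 2" if "p v = h p" for v
    proof (rule no_third_child[OF p])
      show "p (N + 1) \<noteq> 0" using h1 unfolding e(1) by linarith
    qed (use e that in simp_all)
    then have leaf: "?q v \<noteq> h p" for v using h1 by (cases "p v = h p") auto
    have "card {v. ?q v = u} = 0 \<or> card {v. ?q v = u} = 2" if "u \<ge> 1" for u
    proof (cases "u = h p")
      case True
      then have "{v. ?q v = u} = {}" using leaf by blast
      then show ?thesis by simp
    next
      case False
      then have "{v. ?q v = u} = {v. p v = u}" using e that by auto
      moreover have "\<forall>u\<ge>1. card {v. p v = u} = 0 \<or> card {v. p v = u} = 2"
        using p unfolding parent_maps_def by blast
      ultimately show ?thesis using that by metis
    qed
    moreover have "?q v = 0" if "v \<notin> {2..N}" for v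
      using parent_maps_outside[OF p, of v] that by auto
    moreover have "1 \<le> ?q v \<and> ?q v < v" if "v \<in> {2..N}" for v
      using parent_maps_inside[OF p, of v] that by auto
    ultimately have "?q \<in> parent_maps N" unfolding parent_maps_def by blast
    then show "?q \<in> parent_maps N \<and> (\<forall>v. ?q v \<noteq> h ?q) \<and> R ?q" using leaf R up by metis
  qed
  show "(\<lambda>q. q(N + 1 := h q, N + 2 := h q)) ` ?Q \<subseteq> ?P"
  proof clarify
    fix q assume q: "q \<in> parent_maps N" and leaf: "\<forall>v. q v \<noteq> h q" and R: "R q"
    let ?p = "q(N + 1 := h q, N + 2 := h q)"
    have hN: "1 \<le> h q" "h q \<le> N" using h[OF q R] by auto
    have "card {v. ?p v = u} = 0 \<or> card {v. ?p v = u} = 2" if "u \<ge> 1" for u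
    proof (cases "u = h q")
      case True
      then have "{v. ?p v = u} = {N + 1, N + 2}" using leaf by auto
      then show ?thesis by simp
    next
      case False
      then have "{v. ?p v = u} = {v. q v = u}" using that parent_maps_outside[OF q] by auto
      moreover have "\<forall>u\<ge>1. card {v. q v = u} = 0 \<or> card {v. q v = u} = 2"
        using q unfolding parent_maps_def by blast
      ultimately show ?thesis using that by metis
    qed
    moreover have "?p v = 0" if "v \<notin> {2..N + 2}" for v
      using parent_maps_outside[OF q, of v] that \<open>N \<ge> 1\<close> by auto
    moreover have "1 \<le> ?p v \<and> ?p v < v" if "v \<in> {2..N + 2}" for v
      using parent_maps_inside[OF q, of v] that hN by auto
    ultimately have "?p \<in> parent_maps (N + 2)" unfolding parent_maps_def by blast
    then show "?p \<in> parent_maps (N + 2) \<and> ?p (N + 1) = h ?p \<and> ?p (N + 2) = h ?p \<and> R ?p"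
      using R up by simp
  qed
qed

abbreviation leaf :: "(nat \<Rightarrow> nat) \<Rightarrow> nat \<Rightarrow> bool" where
  "leaf p u \<equiv> \<forall>v. p v \<noteq> u"

section \<open>Local rearrangements\<close>

text \<open>With \<open>\<sigma> = rot a\<close> and \<open>\<tau> = rot_inv a\<close> the map
  \<open>\<sigma> \<circ> p \<circ> \<tau>\<close> is a pure relabelling: the vertex
  \<open>a\<close> moves behind the next two, which slide down by one.\<close>

definition rot :: "nat \<Rightarrow> nat \<Rightarrow> nat" where
  "rot a x = (if x = a then a + 2 else if x = a + 1 then a else if x = a + 2 then a + 1 else x)"

definition rot_inv :: "nat \<Rightarrow> nat \<Rightarrow> nat" where
  "rot_inv a x = (if x = a then a + 1 else if x = a + 1 then a + 2 else if x = a + 2 then a else x)"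

lemma rot_rot_inv [simp]: "rot a (rot_inv a x) = x" "rot_inv a (rot a x) = x"
  by (auto simp: rot_def rot_inv_def)

section \<open>Label moves for the lower triangle\<close>

lemma count_lower_swap:
  assumes "k < m" "2 \<le> m" "m + 1 < N"
  shows "count N (\<lambda>p. p m \<noteq> chain_end p m \<and> p (m + 1) = chain_end p m \<and> leaf p (m + 1) \<and> p N = k) =
    count N (\<lambda>p. p m = chain_end p m \<and> p (m + 1) \<noteq> chain_end p m \<and> leaf p m \<and> p N = k)"
\<comment> \<open>Equal transpositions \<open>\<sigma>\<close> and \<open>\<tau>\<close> just
  relabel the vertices. This is allowed because \<open>m + 1\<close> is not a child of
  \<open>m\<close> on either side; \<open>N\<close> and its parent \<open>k < m\<close> stay
  fixed.\<close>
proof (rule count_transform[where \<sigma> = "transpose (m) (m + 1)" and \<sigma>' = "transpose (m) (m + 1)"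
      and \<tau> = "transpose (m) (m + 1)" and \<tau>' = "transpose (m) (m + 1)" and s = m], goal_cases)
  case (8 p w)
  then show ?case using assms chain_end_less[OF 8(1) assms(2)] parent_maps_inside[OF 8(1), of "m"] parent_maps_inside[OF 8(1), of "m + 1"]
    by (auto simp: transpose_def)
next
  case (9 p w)
  have "p (m + 1) < m \<or> m < p (m + 1)" using 9(2) by (auto simp: neq_iff[symmetric])
  with 9 show ?case using assms chain_end_less[OF 9(1) assms(2)] parent_maps_inside[OF 9(1), of "m"] parent_maps_inside[OF 9(1), of "m + 1"]
    by (auto simp: transpose_def)
next
  case (10 p q)
  then show ?case using assms chain_end_less[OF 10(1) assms(2)] parent_maps_inside[OF 10(1), of "m"] parent_maps_inside[OF 10(1), of "m + 1"]
    by (auto simp: transpose_def split: if_splits)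
next
  case (11 q p)
  have "p (m + 1) < m \<or> m < p (m + 1)" using 11(2) by (auto simp: neq_iff[symmetric])
  with 11 show ?case using assms chain_end_less[OF 11(1) assms(2)] parent_maps_inside[OF 11(1), of "m"] parent_maps_inside[OF 11(1), of "m + 1"]
    by (auto simp: transpose_def split: if_splits)
qed (use assms in \<open>auto simp: transpose_def split: if_splits\<close>)

text \<open>The chain piece \<open>m + 1\<close>, \<open>m + 2\<close> slides down to
  \<open>m\<close>, \<open>m + 1\<close>, and the old \<open>m\<close> becomes \<open>m + 2\<close>,
  its children all being larger. Backwards, \<open>m + 2\<close> may drop to \<open>m\<close>
  because neither \<open>m\<close> nor the leaf \<open>m + 1\<close> is its parent.\<close>

lemma count_lower_rot_child:
  assumes "k < m" "2 \<le> m" "m + 2 < N"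
  shows "count N (\<lambda>p. p m \<noteq> chain_end p m \<and> p (m + 1) = chain_end p m \<and> p (m + 2) = m + 1 \<and> leaf p (m + 2) \<and> p N = k) =
    count N (\<lambda>p. p m = chain_end p m \<and> p (m + 1) = m \<and> p (m + 2) \<noteq> m \<and> p (m + 2) \<noteq> chain_end p m \<and> leaf p (m + 1) \<and> p N = k)"
proof (rule count_transform[where \<sigma> = "rot m" and \<sigma>' = "rot_inv m"
      and \<tau> = "rot_inv m" and \<tau>' = "rot m" and s = m], goal_cases)
  case (8 p w)
  then show ?case using assms chain_end_less[OF 8(1) assms(2)] parent_maps_inside[OF 8(1), of "m"] parent_maps_inside[OF 8(1), of "m + 2"]
    by (auto simp: rot_def rot_inv_def)
next
  case (9 p w)
  have "p (m + 2) < m + 1 \<or> m + 1 < p (m + 2)" using 9(2) by (auto simp: neq_iff[symmetric])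
  with 9 show ?case using assms chain_end_less[OF 9(1) assms(2)] parent_maps_inside[OF 9(1), of "m"] parent_maps_inside[OF 9(1), of "m + 2"]
    by (auto simp: rot_def rot_inv_def)
next
  case (10 p q)
  then show ?case using assms chain_end_less[OF 10(1) assms(2)] parent_maps_inside[OF 10(1), of "m"] parent_maps_inside[OF 10(1), of "m + 2"]
    by (auto simp: rot_def rot_inv_def split: if_splits)
next
  case (11 q p)
  have "p (m + 2) < m + 1 \<or> m + 1 < p (m + 2)" using 11(2) by (auto simp: neq_iff[symmetric])
  with 11 show ?case using assms chain_end_less[OF 11(1) assms(2)] parent_maps_inside[OF 11(1), of "m"] parent_maps_inside[OF 11(1), of "m + 2"]
    by (auto simp: rot_def rot_inv_def split: if_splits)
qed (use assms in \<open>auto simp: rot_def rot_inv_def split: if_splits\<close>)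

text \<open>The siblings \<open>m + 1\<close>, \<open>m + 2\<close> slide down to \<open>m\<close>,
  \<open>m + 1\<close>, and the old \<open>m\<close>, hung elsewhere, becomes \<open>m + 2\<close>.
  Backwards, neither the leaf \<open>m\<close> nor \<open>m + 1\<close> is the parent of
  \<open>m + 2\<close>.\<close>

lemma count_lower_rot_sibling:
  assumes "k < m" "2 \<le> m" "m + 2 < N"
  shows "count N (\<lambda>p. p m \<noteq> chain_end p m \<and> p (m + 1) = chain_end p m \<and> p (m + 2) = chain_end p m \<and> leaf p (m + 1) \<and> p N = k) =
    count N (\<lambda>p. p m = chain_end p m \<and> p (m + 1) = chain_end p m \<and> p (m + 2) \<noteq> m + 1 \<and> p (m + 2) \<noteq> chain_end p m \<and> leaf p m \<and> p N = k)"
proof (rule count_transform[where \<sigma> = "rot m" and \<sigma>' = "rot_inv m"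
      and \<tau> = "rot_inv m" and \<tau>' = "rot m" and s = m], goal_cases)
  case (8 p w)
  then show ?case using assms chain_end_less[OF 8(1) assms(2)] parent_maps_inside[OF 8(1), of "m"] parent_maps_inside[OF 8(1), of "m + 2"]
    by (auto simp: rot_def rot_inv_def)
next
  case (9 p w)
  have "p (m + 2) < m \<or> m < p (m + 2)" using 9(2) by (auto simp: neq_iff[symmetric])
  with 9 show ?case using assms chain_end_less[OF 9(1) assms(2)] parent_maps_inside[OF 9(1), of "m"] parent_maps_inside[OF 9(1), of "m + 2"]
    by (auto simp: rot_def rot_inv_def)
next
  case (10 p q)
  then show ?case using assms chain_end_less[OF 10(1) assms(2)] parent_maps_inside[OF 10(1), of "m"] parent_maps_inside[OF 10(1), of "m + 2"]
    by (auto simp: rot_def rot_inv_def split: if_splits)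
next
  case (11 q p)
  have "p (m + 2) < m \<or> m < p (m + 2)" using 11(2) by (auto simp: neq_iff[symmetric])
  with 11 show ?case using assms chain_end_less[OF 11(1) assms(2)] parent_maps_inside[OF 11(1), of "m"] parent_maps_inside[OF 11(1), of "m + 2"]
    by (auto simp: rot_def rot_inv_def split: if_splits)
qed (use assms in \<open>auto simp: rot_def rot_inv_def split: if_splits\<close>)

text \<open>Here \<open>\<sigma>\<close> and \<open>\<tau>\<close> differ, so the shape changes:
  \<open>m\<close> becomes the parent of the other child of \<open>m + 1\<close>,
  \<open>m + 1\<close> becomes the leaf below \<open>m\<close>, and \<open>m + 2\<close> moves up to
  the chain end with its own children.\<close>

lemma count_lower_exchange:
  assumes "k < m" "2 \<le> m" "m + 2 < N"
  shows "count N (\<lambda>p. p m = chain_end p m \<and> p (m + 1) = chain_end p m \<and> p (m + 2) = m + 1 \<and> leaf p m \<and> p N = k) =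
    count N (\<lambda>p. p m = chain_end p m \<and> p (m + 1) = m \<and> p (m + 2) = chain_end p m \<and> leaf p (m + 1) \<and> p N = k)"
proof (rule count_transform[where \<sigma> = "transpose (m) (m + 1)" and \<sigma>' = "transpose (m) (m + 1)"
      and \<tau> = "transpose (m + 1) (m + 2)" and \<tau>' = "transpose (m + 1) (m + 2)" and s = m], goal_cases)
  case (8 p w)
  then show ?case using assms chain_end_less[OF 8(1) assms(2)] parent_maps_inside[OF 8(1), of "m"] parent_maps_inside[OF 8(1), of "m + 2"]
    by (auto simp: transpose_def)
next
  case (9 p w)
  then show ?case using assms chain_end_less[OF 9(1) assms(2)] parent_maps_inside[OF 9(1), of "m"] parent_maps_inside[OF 9(1), of "m + 2"]
    by (auto simp: transpose_def)
next
  case (10 p q)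
  then show ?case using assms chain_end_less[OF 10(1) assms(2)] parent_maps_inside[OF 10(1), of "m"] parent_maps_inside[OF 10(1), of "m + 2"]
    by (auto simp: transpose_def split: if_splits)
next
  case (11 q p)
  then show ?case using assms chain_end_less[OF 11(1) assms(2)] parent_maps_inside[OF 11(1), of "m"] parent_maps_inside[OF 11(1), of "m + 2"]
    by (auto simp: transpose_def split: if_splits)
qed (use assms in \<open>auto simp: transpose_def split: if_splits\<close>)

text \<open>The labels \<open>m + 2\<close> and \<open>d\<close> trade places as children, while
  \<open>m + 1\<close> and \<open>m + 2\<close> trade their sets of children. Afterwards
  \<open>d\<close> is one of the two children of \<open>m + 2\<close>, and naming \<open>d\<close>
  records which one.\<close>

lemma count_lower_regraft:
  assumes "k < m" "2 \<le> m" "m + 2 < N" "d \<in> {m+3..N}"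
  shows "count N (\<lambda>p. (p m = chain_end p m \<and> p (m + 1) = m \<and> p (m + 2) = m + 1 \<and> leaf p (m + 2) \<and> p N = k) \<and> p d = m) =
    count N (\<lambda>p. (p m = chain_end p m \<and> p (m + 1) = m \<and> p (m + 2) = m \<and> leaf p (m + 1) \<and> \<not> leaf p (m + 2) \<and> p N = k) \<and> p d = m + 2)"
proof (rule count_transform[where \<sigma> = "transpose (m + 1) (m + 2)" and \<sigma>' = "transpose (m + 1) (m + 2)"
      and \<tau> = "transpose (m + 2) (d)" and \<tau>' = "transpose (m + 2) (d)" and s = m], goal_cases)
  case (8 p w)
  then show ?case using assms chain_end_less[OF 8(1) assms(2)] parent_maps_inside[OF 8(1), of "m"] parent_maps_inside[OF 8(1), of "m + 2"]
    by (auto simp: transpose_def)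
next
  case (9 p w)
  then show ?case using assms chain_end_less[OF 9(1) assms(2)] parent_maps_inside[OF 9(1), of "m"] parent_maps_inside[OF 9(1), of "m + 2"]
    by (auto simp: transpose_def)
next
  case (10 p q)
  then show ?case using assms chain_end_less[OF 10(1) assms(2)] parent_maps_inside[OF 10(1), of "m"] parent_maps_inside[OF 10(1), of "m + 2"]
    by (auto simp: transpose_def split: if_splits)
next
  case (11 q p)
  then show ?case using assms chain_end_less[OF 11(1) assms(2)] parent_maps_inside[OF 11(1), of "m"] parent_maps_inside[OF 11(1), of "m + 2"]
    by (auto simp: transpose_def split: if_splits)
qed (use assms in \<open>auto simp: transpose_def split: if_splits\<close>)

section \<open>Label moves for the upper triangle\<close>

lemma count_upper_swap:
  assumes "m < k" "1 \<le> m" "k + 1 < N"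
  shows "count N (\<lambda>p. p m = chain_end p m \<and> leaf p m \<and> p N = k + 1 \<and> p (k + 1) \<noteq> k) =
    count N (\<lambda>p. p m = chain_end p m \<and> leaf p m \<and> p N = k \<and> p (k + 1) \<noteq> k)"
\<comment> \<open>All moves for the upper triangle fix the labels below \<open>k\<close>, hence the
  chain up to \<open>m < k\<close>. As \<open>k + 1\<close> is not a child of \<open>k\<close>, the
  two may be relabelled, which carries the parent of \<open>N\<close> from \<open>k + 1\<close> to
  \<open>k\<close>.\<close>
proof (rule count_transform[where \<sigma> = "transpose (k) (k + 1)" and \<sigma>' = "transpose (k) (k + 1)"
      and \<tau> = "transpose (k) (k + 1)" and \<tau>' = "transpose (k) (k + 1)" and s = k], goal_cases)
  case (8 p w)
  then show ?case using assms parent_maps_less[OF 8(1), of m] parent_maps_inside[OF 8(1), of "k"] parent_maps_inside[OF 8(1), of "k + 1"]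
    by (auto simp: transpose_def)
next
  case (9 p w)
  then show ?case using assms parent_maps_less[OF 9(1), of m] parent_maps_inside[OF 9(1), of "k"] parent_maps_inside[OF 9(1), of "k + 1"]
    by (auto simp: transpose_def)
next
  case (10 p q)
  then show ?case using assms parent_maps_less[OF 10(1), of m] parent_maps_inside[OF 10(1), of "k"] parent_maps_inside[OF 10(1), of "k + 1"]
    by (auto simp: transpose_def split: if_splits)
next
  case (11 q p)
  then show ?case using assms parent_maps_less[OF 11(1), of m] parent_maps_inside[OF 11(1), of "k"] parent_maps_inside[OF 11(1), of "k + 1"]
    by (auto simp: transpose_def split: if_splits)
qed (use assms in \<open>auto simp: transpose_def split: if_splits\<close>)

text \<open>The vertex \<open>k + 1\<close> with children \<open>k + 2\<close> and \<open>N\<close>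
  slides down to \<open>k\<close> with children \<open>k + 1\<close> and \<open>N\<close>; the old
  \<open>k\<close> becomes \<open>k + 2\<close>, with a parent below \<open>k\<close>.\<close>

lemma count_upper_rot_sibling:
  assumes "m < k" "1 \<le> m" "k + 2 < N"
  shows "count N (\<lambda>p. p m = chain_end p m \<and> leaf p m \<and> p N = k + 1 \<and> p (k + 2) = k + 1 \<and> p (k + 1) \<noteq> k) =
    count N (\<lambda>p. p m = chain_end p m \<and> leaf p m \<and> p N = k \<and> p (k + 1) = k \<and> p (k + 2) \<noteq> k + 1 \<and> p (k + 2) \<noteq> k)"
proof (rule count_transform[where \<sigma> = "rot k" and \<sigma>' = "rot_inv k"
      and \<tau> = "rot_inv k" and \<tau>' = "rot k" and s = k], goal_cases)
  case (8 p w)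
  then show ?case using assms parent_maps_less[OF 8(1), of m] parent_maps_inside[OF 8(1), of "k"] parent_maps_inside[OF 8(1), of "k + 1"] parent_maps_inside[OF 8(1), of "k + 2"]
    by (auto simp: rot_def rot_inv_def)
next
  case (9 p w)
  then show ?case using assms parent_maps_less[OF 9(1), of m] parent_maps_inside[OF 9(1), of "k"] parent_maps_inside[OF 9(1), of "k + 1"] parent_maps_inside[OF 9(1), of "k + 2"]
    by (auto simp: rot_def rot_inv_def)
next
  case (10 p q)
  then show ?case using assms parent_maps_less[OF 10(1), of m] parent_maps_inside[OF 10(1), of "k"] parent_maps_inside[OF 10(1), of "k + 1"] parent_maps_inside[OF 10(1), of "k + 2"]
    by (auto simp: rot_def rot_inv_def split: if_splits)
next
  case (11 q p)
  then show ?case using assms parent_maps_less[OF 11(1), of m] parent_maps_inside[OF 11(1), of "k"] parent_maps_inside[OF 11(1), of "k + 1"] parent_maps_inside[OF 11(1), of "k + 2"]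
    by (auto simp: rot_def rot_inv_def split: if_splits)
qed (use assms in \<open>auto simp: rot_def rot_inv_def split: if_splits\<close>)

text \<open>The path \<open>k + 1\<close>, \<open>k + 2\<close>, \<open>N\<close> slides down to
  \<open>k\<close>, \<open>k + 1\<close>, \<open>N\<close>, and the old \<open>k\<close> becomes
  \<open>k + 2\<close>.\<close>

lemma count_upper_rot_child:
  assumes "m < k" "1 \<le> m" "k + 2 < N"
  shows "count N (\<lambda>p. p m = chain_end p m \<and> leaf p m \<and> p N = k + 2 \<and> p (k + 2) = k + 1 \<and> p (k + 1) \<noteq> k) =
    count N (\<lambda>p. p m = chain_end p m \<and> leaf p m \<and> p N = k + 1 \<and> p (k + 1) = k \<and> p (k + 2) \<noteq> k + 1 \<and> p (k + 2) \<noteq> k)"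
proof (rule count_transform[where \<sigma> = "rot k" and \<sigma>' = "rot_inv k"
      and \<tau> = "rot_inv k" and \<tau>' = "rot k" and s = k], goal_cases)
  case (8 p w)
  then show ?case using assms parent_maps_less[OF 8(1), of m] parent_maps_inside[OF 8(1), of "k"] parent_maps_inside[OF 8(1), of "k + 1"] parent_maps_inside[OF 8(1), of "k + 2"]
    by (auto simp: rot_def rot_inv_def)
next
  case (9 p w)
  then show ?case using assms parent_maps_less[OF 9(1), of m] parent_maps_inside[OF 9(1), of "k"] parent_maps_inside[OF 9(1), of "k + 1"] parent_maps_inside[OF 9(1), of "k + 2"]
    by (auto simp: rot_def rot_inv_def)
next
  case (10 p q)
  then show ?case using assms parent_maps_less[OF 10(1), of m] parent_maps_inside[OF 10(1), of "k"] parent_maps_inside[OF 10(1), of "k + 1"] parent_maps_inside[OF 10(1), of "k + 2"]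
    by (auto simp: rot_def rot_inv_def split: if_splits)
next
  case (11 q p)
  then show ?case using assms parent_maps_less[OF 11(1), of m] parent_maps_inside[OF 11(1), of "k"] parent_maps_inside[OF 11(1), of "k + 1"] parent_maps_inside[OF 11(1), of "k + 2"]
    by (auto simp: rot_def rot_inv_def split: if_splits)
qed (use assms in \<open>auto simp: rot_def rot_inv_def split: if_splits\<close>)

text \<open>In effect \<open>N\<close>, a child of \<open>k\<close>, trades places with the child of
  \<open>k + 1\<close> other than \<open>k + 2\<close>. The chosen permutations achieve this without
  naming that child.\<close>

lemma count_upper_exchange:
  assumes "m < k" "1 \<le> m" "k + 2 < N"
  shows "count N (\<lambda>p. p m = chain_end p m \<and> leaf p m \<and> p N = k \<and> p (k + 1) = k \<and> p (k + 2) = k + 1) =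
    count N (\<lambda>p. p m = chain_end p m \<and> leaf p m \<and> p N = k + 1 \<and> p (k + 1) = k \<and> p (k + 2) = k + 1)"
proof (rule count_transform[where \<sigma> = "transpose (k) (k + 1)" and \<sigma>' = "transpose (k) (k + 1)"
      and \<tau> = "transpose (k + 1) (k + 2)" and \<tau>' = "transpose (k + 1) (k + 2)" and s = k], goal_cases)
  case (8 p w)
  then show ?case using assms parent_maps_less[OF 8(1), of m] parent_maps_inside[OF 8(1), of "k"] parent_maps_inside[OF 8(1), of "k + 1"] parent_maps_inside[OF 8(1), of "k + 2"]
    by (auto simp: transpose_def)
next
  case (9 p w)
  then show ?case using assms parent_maps_less[OF 9(1), of m] parent_maps_inside[OF 9(1), of "k"] parent_maps_inside[OF 9(1), of "k + 1"] parent_maps_inside[OF 9(1), of "k + 2"]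
    by (auto simp: transpose_def)
next
  case (10 p q)
  then show ?case using assms parent_maps_less[OF 10(1), of m] parent_maps_inside[OF 10(1), of "k"] parent_maps_inside[OF 10(1), of "k + 1"] parent_maps_inside[OF 10(1), of "k + 2"]
    by (auto simp: transpose_def split: if_splits)
next
  case (11 q p)
  then show ?case using assms parent_maps_less[OF 11(1), of m] parent_maps_inside[OF 11(1), of "k"] parent_maps_inside[OF 11(1), of "k + 1"] parent_maps_inside[OF 11(1), of "k + 2"]
    by (auto simp: transpose_def split: if_splits)
qed (use assms in \<open>auto simp: transpose_def split: if_splits\<close>)

text \<open>In effect \<open>k + 2\<close>, a child of \<open>k\<close>, trades places with the
  child of \<open>k + 1\<close> other than \<open>N\<close>.\<close>

lemma count_upper_exchange_top:
  assumes "m < k" "1 \<le> m" "k + 2 < N"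
  shows "count N (\<lambda>p. p m = chain_end p m \<and> leaf p m \<and> p N = k + 1 \<and> p (k + 1) = k \<and> p (k + 2) = k) =
    count N (\<lambda>p. p m = chain_end p m \<and> leaf p m \<and> p N = k + 1 \<and> p (k + 1) = k \<and> p (k + 2) = k + 1)"
proof (rule count_transform[where \<sigma> = "transpose (k) (k + 1)" and \<sigma>' = "transpose (k) (k + 1)"
      and \<tau> = "transpose (k + 1) (N)" and \<tau>' = "transpose (k + 1) (N)" and s = k], goal_cases)
  case (8 p w)
  then show ?case using assms parent_maps_less[OF 8(1), of m] parent_maps_inside[OF 8(1), of "k"] parent_maps_inside[OF 8(1), of "k + 1"] parent_maps_inside[OF 8(1), of "k + 2"]
    by (auto simp: transpose_def)
next
  case (9 p w)
  then show ?case using assms parent_maps_less[OF 9(1), of m] parent_maps_inside[OF 9(1), of "k"] parent_maps_inside[OF 9(1), of "k + 1"] parent_maps_inside[OF 9(1), of "k + 2"]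
    by (auto simp: transpose_def)
next
  case (10 p q)
  then show ?case using assms parent_maps_less[OF 10(1), of m] parent_maps_inside[OF 10(1), of "k"] parent_maps_inside[OF 10(1), of "k + 1"] parent_maps_inside[OF 10(1), of "k + 2"]
    by (auto simp: transpose_def split: if_splits)
next
  case (11 q p)
  then show ?case using assms parent_maps_less[OF 11(1), of m] parent_maps_inside[OF 11(1), of "k"] parent_maps_inside[OF 11(1), of "k + 1"] parent_maps_inside[OF 11(1), of "k + 2"]
    by (auto simp: transpose_def split: if_splits)
qed (use assms in \<open>auto simp: transpose_def split: if_splits\<close>)

text \<open>Only \<open>d\<close> and \<open>N\<close> trade parents. The range of \<open>d\<close>
  stops before \<open>N\<close>, since \<open>N\<close> is the other label taking part.\<close>

lemma count_upper_regraft: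
  assumes "m < k" "1 \<le> m" "k + 2 < N" "d \<in> {k+3..<N}"
  shows "count N (\<lambda>p. (p m = chain_end p m \<and> leaf p m \<and> p N = k + 2 \<and> p (k + 1) = k \<and> p (k + 2) = k + 1) \<and> p d = k + 1) =
    count N (\<lambda>p. (p m = chain_end p m \<and> leaf p m \<and> p N = k + 1 \<and> p (k + 1) = k \<and> p (k + 2) = k + 1 \<and> \<not> leaf p (k + 2)) \<and> p d = k + 2)"
proof (rule count_transform[where \<sigma> = "\<lambda>x. x" and \<sigma>' = "\<lambda>x. x"
      and \<tau> = "transpose (d) (N)" and \<tau>' = "transpose (d) (N)" and s = k], goal_cases)
  case (8 p w)
  then show ?case using assms parent_maps_less[OF 8(1), of m] parent_maps_inside[OF 8(1), of "k"] parent_maps_inside[OF 8(1), of "k + 1"] parent_maps_inside[OF 8(1), of "k + 2"]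
    by (auto simp: transpose_def)
next
  case (9 p w)
  then show ?case using assms parent_maps_less[OF 9(1), of m] parent_maps_inside[OF 9(1), of "k"] parent_maps_inside[OF 9(1), of "k + 1"] parent_maps_inside[OF 9(1), of "k + 2"]
    by (auto simp: transpose_def)
next
  case (10 p q)
  then show ?case using assms parent_maps_less[OF 10(1), of m] parent_maps_inside[OF 10(1), of "k"] parent_maps_inside[OF 10(1), of "k + 1"] parent_maps_inside[OF 10(1), of "k + 2"]
    by (auto simp: transpose_def split: if_splits intro!: exI[of _ d])
next
  case (11 q p)
  then show ?case using assms parent_maps_less[OF 11(1), of m] parent_maps_inside[OF 11(1), of "k"] parent_maps_inside[OF 11(1), of "k + 1"] parent_maps_inside[OF 11(1), of "k + 2"]
    by (auto simp: transpose_def split: if_splits)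
qed (use assms in \<open>auto simp: transpose_def split: if_splits\<close>)

section \<open>Removal of two vertices, and double counting\<close>

definition tree_count :: "nat \<Rightarrow> nat \<Rightarrow> nat \<Rightarrow> nat" where
  "tree_count N m k = count N (\<lambda>p. p m = chain_end p m \<and> leaf p m \<and> p N = k)"

text \<open>\<open>shift a M\<close> moves the labels \<open>a + 1\<close>, \<open>a + 2\<close> to the top \<open>M - 1\<close>, \<open>M\<close> of the range \<open>{a<..M}\<close>, so
  that removing these two vertices becomes an instance of \<open>count_insert_top\<close>.\<close>

definition shift :: "nat \<Rightarrow> nat \<Rightarrow> nat \<Rightarrow> nat" where
  "shift a M x = (if x = a + 1 then M - 1 else if x = a + 2 then M
     else if a < x \<and> x \<le> M then x - 2 else x)"

definition shift_inv :: "nat \<Rightarrow> nat \<Rightarrow> nat \<Rightarrow> nat" where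
  "shift_inv a M x = (if x = M - 1 then a + 1 else if x = M then a + 2
     else if a < x \<and> x < M - 1 then x + 2 else x)"

lemma shift_shift_inv:
  "a + 2 \<le> M \<Longrightarrow> shift a M (shift_inv a M x) = x" "a + 2 \<le> M \<Longrightarrow> shift_inv a M (shift a M x) = x"
  by (auto simp: shift_def shift_inv_def)

lemma shift_inv_range:
  "1 \<le> a \<Longrightarrow> a + 2 \<le> M \<Longrightarrow> M \<le> N \<Longrightarrow> shift_inv a M x \<in> {2..N} \<longleftrightarrow> x \<in> {2..N}"
  by (auto simp: shift_inv_def)

lemma count_lower_contract:
  assumes "k < m" "2 \<le> m" "m < N"
  shows "count (N + 2) (\<lambda>p. p m = chain_end p m \<and> p (m + 1) = m \<and> p (m + 2) = m \<and>
      leaf p (m + 1) \<and> leaf p (m + 2) \<and> p (N + 2) = k) = tree_count N m k"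
proof -
  have "count (N + 2) (\<lambda>p. p m = chain_end p m \<and> p (m + 1) = m \<and> p (m + 2) = m \<and>
      leaf p (m + 1) \<and> leaf p (m + 2) \<and> p (N + 2) = k) =
    count (N + 2) (\<lambda>p. p (N + 1) = m \<and> p (N + 2) = m \<and> p m = chain_end p m \<and> p N = k)"
  \<comment> \<open>With \<open>M = N + 2\<close> the former top label becomes \<open>N\<close> and
    keeps its parent \<open>k < m\<close>. The labels \<open>m + 1\<close> and \<open>m + 2\<close>
    may move to the top because they are leaves.\<close>
  proof (rule count_transform[where \<sigma> = "shift m (N + 2)" and \<sigma>' = "shift_inv m (N + 2)"
      and \<tau> = "shift_inv m (N + 2)" and \<tau>' = "shift m (N + 2)" and s = m], goal_cases)
    case (8 p w)
    have "p w \<noteq> m + 1" "p w \<noteq> m + 2" using 8(2) by auto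
    then have "p w < m + 1 \<or> m + 2 < p w" by linarith
    with 8 show ?case using assms chain_end_less[OF 8(1) assms(2)] by (auto simp: shift_def)
  next
    case (9 p w)
    then show ?case using assms chain_end_less[OF 9(1) assms(2)] by (auto simp: shift_inv_def)
  next
    case (10 p q)
    then show ?case using assms chain_end_less[OF 10(1) assms(2)]
      by (auto simp: shift_def shift_inv_def)
  next
    case (11 p q)
    have "p v \<noteq> m + 1 \<and> p v \<noteq> m + 2" for v
    proof -
      have "q w \<noteq> N + 1 \<and> q w \<noteq> N + 2" for w
        using parent_maps_less[OF 11(1), of w] 11(2) assms by (cases "w = N + 2") auto
      from this[of "shift m (N + 2) v"] show ?thesis
        unfolding 11(3) using assms by (auto simp: shift_inv_def)
    qed
    with 11 show ?case using assms chain_end_less[OF 11(1) assms(2)]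
      by (auto simp: shift_def shift_inv_def)
  next
    case (5 x)
    then show ?case using assms by (auto simp: shift_def shift_inv_def)
  next
    case (7 v)
    show ?case by (rule shift_inv_range) (use assms in auto)
  qed (use assms in \<open>simp_all add: shift_shift_inv\<close>)
  also have "\<dots> = count N (\<lambda>p. leaf p m \<and> p m = chain_end p m \<and> p N = k)"
  proof (rule count_insert_top[where h = "\<lambda>_. m" and R = "\<lambda>p. p m = chain_end p m \<and> p N = k"], goal_cases)
    case (1 p q)
    then show ?case using assms chain_end_cong[of m p q] by auto
  qed (use assms in auto)
  also have "\<dots> = tree_count N m k" unfolding tree_count_def by (rule count_cong) auto
  finally show ?thesis .
qed

text \<open>The children of \<open>k + 1\<close> are the leaves \<open>k + 2\<close> and
  \<open>N + 2\<close>. Without them \<open>k + 1\<close> is a leaf, which can be given the top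
  label \<open>N\<close> of the smaller tree; so the new maximum hangs at \<open>k\<close>.\<close>

lemma count_upper_contract:
  assumes "m < k" "1 \<le> m" "k < N"
  shows "count (N + 2) (\<lambda>p. p m = chain_end p m \<and> leaf p m \<and> p (N + 2) = k + 1 \<and>
      p (k + 1) = k \<and> p (k + 2) = k + 1 \<and> leaf p (k + 2)) = tree_count N m k"
proof -
  \<comment> \<open>The leaf condition on \<open>m\<close> is restricted to
    \<open>v \<le> N\<close>, because \<open>count_insert_top\<close> admits only conditions on
    labels up to \<open>N\<close>.\<close>
  have "count (N + 2) (\<lambda>p. p m = chain_end p m \<and> leaf p m \<and> p (N + 2) = k + 1 \<and>
      p (k + 1) = k \<and> p (k + 2) = k + 1 \<and> leaf p (k + 2)) =
    count (N + 2) (\<lambda>p. p (N + 1) = N \<and> p (N + 2) = N \<and>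
      p m = chain_end p m \<and> (\<forall>v\<le>N. p v \<noteq> m) \<and> p N = k)"
  \<comment> \<open>Choosing \<open>M = N + 1\<close> keeps the top label \<open>N + 2\<close> in
    place, while \<open>k + 1\<close> goes to \<open>N\<close> and \<open>k + 2\<close> to
    \<open>N + 1\<close>.\<close>
  proof (rule count_transform[where \<sigma> = "shift k (N + 1)" and \<sigma>' = "shift_inv k (N + 1)"
      and \<tau> = "shift_inv k (N + 1)" and \<tau>' = "shift k (N + 1)" and s = k], goal_cases)
    case (8 p w)
    then have "p w < k + 2 \<or> k + 2 < p w" by (auto simp: neq_iff[symmetric])
    \<comment> \<open>Raising the parent \<open>k + 1\<close> to \<open>N\<close> is harmless, since
      its only children end up above \<open>N\<close>.\<close>
    moreover have "w = k + 2 \<or> w = N + 2" if "p w = k + 1"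
      using no_third_child[OF 8(1), of "k + 2" "N + 2" w] that 8 assms by auto
    ultimately show ?case using assms 8 by (auto simp: shift_def)
  next
    case (9 p w)
    then show ?case using assms by (auto simp: shift_inv_def)
  next
    case (10 p q)
    have "p m < k" using parent_maps_less[OF 10(1), of m] assms by (cases "p m = 0") auto
    then have "q m = chain_end q m" using 10(2) 10(4)[of m] assms unfolding 10(3)
      by (simp add: shift_def shift_inv_def)
    moreover have "q v \<noteq> m" for v
    proof -
      have "p (shift_inv k (N + 1) v) \<noteq> m" using 10(2) by blast
      then show ?thesis unfolding 10(3) using assms by (auto simp: shift_def)
    qed
    moreover have "q (N + 1) = N" "q (N + 2) = N" "q N = k"
      unfolding 10(3) using 10(2) assms by (auto simp: shift_def shift_inv_def)
    ultimately show ?case by simp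
  next
    case (11 p q)
    have "p v \<noteq> k + 2 \<and> p v \<noteq> m" for v
    proof -
      have "q w \<noteq> N + 1 \<and> q w \<noteq> m" for w
      proof (cases "w \<le> N")
        case True
        then show ?thesis using parent_maps_less[OF 11(1), of w] 11(2) by (cases "q w = 0") auto
      next
        case False
        then have "w = N + 1 \<or> w = N + 2 \<or> w \<notin> {2..N + 2}" by auto
        then have "q w = N \<or> q w = 0" using 11(2) parent_maps_outside[OF 11(1), of w] by metis
        then show ?thesis using assms by auto
      qed
      from this[of "shift k (N + 1) v"] show ?thesis
        unfolding 11(3) using assms by (auto simp: shift_inv_def)
    qed
    moreover have "q m < k" using parent_maps_less[OF 11(1), of m] assms by (cases "q m = 0") auto
    then have "p m = chain_end p m" using 11(2) 11(4)[of m] assms unfolding 11(3)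
      by (simp add: shift_def shift_inv_def)
    moreover have "p (N + 2) = k + 1" "p (k + 1) = k" "p (k + 2) = k + 1"
      unfolding 11(3) using 11(2) assms by (auto simp: shift_def shift_inv_def)
    ultimately show ?case by simp
  next
    case (5 x)
    then show ?case using assms by (auto simp: shift_def shift_inv_def)
  next
    case (7 v)
    show ?case by (rule shift_inv_range) (use assms in auto)
  qed (use assms in \<open>simp_all add: shift_shift_inv\<close>)
  also have "\<dots> = count N (\<lambda>p. leaf p N \<and> p m = chain_end p m \<and> (\<forall>v\<le>N. p v \<noteq> m) \<and> p N = k)"
  proof (rule count_insert_top[where h = "\<lambda>_. N"
        and R = "\<lambda>p. p m = chain_end p m \<and> (\<forall>v\<le>N. p v \<noteq> m) \<and> p N = k"], goal_cases)
    case (1 p q)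
    then show ?case using assms chain_end_cong[of m p q] by auto
  qed (use assms in auto)
  also have "\<dots> = tree_count N m k" unfolding tree_count_def
  proof (rule count_cong)
    fix p assume p: "p \<in> parent_maps N"
    have "leaf p N" using parent_maps_less[OF p] assms by (metis less_nat_zero_code not_less)
    moreover have "p v \<noteq> m" if "v > N" for v using parent_maps_outside[OF p, of v] that assms by auto
    ultimately show "(leaf p N \<and> p m = chain_end p m \<and> (\<forall>v\<le>N. p v \<noteq> m) \<and> p N = k) =
      (p m = chain_end p m \<and> leaf p m \<and> p N = k)" by (metis not_le)
  qed
  finally show ?thesis .
qed

text \<open>Regrafting matches the counts for each \<open>d\<close>. On the left \<open>d\<close> is
  the unique child of \<open>m\<close> other than \<open>m + 1\<close>; on the right it may be
  either child of \<open>m + 2\<close>.\<close>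

lemma count_lower_double:
  assumes "k < m" "2 \<le> m" "m + 2 < N"
  shows "count N (\<lambda>p. p m = chain_end p m \<and> p (m + 1) = m \<and> p (m + 2) = m + 1 \<and> leaf p (m + 2) \<and> p N = k) =
    2 * count N (\<lambda>p. p m = chain_end p m \<and> p (m + 1) = m \<and> p (m + 2) = m \<and> leaf p (m + 1) \<and>
      \<not> leaf p (m + 2) \<and> p N = k)" (is "count N ?P = 2 * count N ?Q")
proof -
  have "1 * count N ?P = (\<Sum>d\<in>{m+3..N}. count N (\<lambda>p. ?P p \<and> p d = m))"
  proof (rule sum_count_indexed[symmetric])
    fix p assume p: "p \<in> parent_maps N" "?P p"
    obtain b where b: "b \<noteq> m + 1" "{v. p v = p (m + 1)} = {m + 1, b}"
      using sibling_exists[OF p(1), of "m + 1"] p(2) assms by auto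
    then have pb: "p b = m" using p(2) by auto
    then have b_in: "b \<in> {m+3..N}" using parent_maps_less[OF p(1), of b] p(2) b(1) assms
      by (cases "b = m + 2") auto
    have "d = b" if "d \<in> {m+3..N}" "p d = m" for d
      using no_third_child[OF p(1), of "m + 1" b d] p(2) pb b(1) that assms by auto
    then have "{d \<in> {m+3..N}. p d = m} = {b}" using b_in pb by blast
    then show "card {d \<in> {m+3..N}. p d = m} = 1" by simp
  qed simp
  also have "\<dots> = (\<Sum>d\<in>{m+3..N}. count N (\<lambda>p. ?Q p \<and> p d = m + 2))"
    using count_lower_regraft[OF assms] by simp
  also have "\<dots> = 2 * count N ?Q"
  proof (rule sum_count_indexed)
    fix p assume p: "p \<in> parent_maps N" "?Q p"
    then obtain a where "p a = m + 2" by blast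
    then have "card {v. p v = m + 2} = 2" by (rule card_fibre[OF p(1), rotated]) simp
    moreover have "d \<in> {m+3..N}" if "p d = m + 2" for d
      using that parent_maps_less[OF p(1), of d] by auto
    then have "{d \<in> {m+3..N}. p d = m + 2} = {v. p v = m + 2}" by blast
    ultimately show "card {d \<in> {m+3..N}. p d = m + 2} = 2" by simp
  qed simp
  finally show ?thesis by simp
qed

text \<open>On the left \<open>d\<close> is the unique child of \<open>k + 1\<close> other than
  \<open>k + 2\<close>; on the right it may be either child of \<open>k + 2\<close>.\<close>

lemma count_upper_double:
  assumes "m < k" "1 \<le> m" "k + 2 < N"
  shows "count N (\<lambda>p. p m = chain_end p m \<and> leaf p m \<and> p N = k + 2 \<and> p (k + 1) = k \<and> p (k + 2) = k + 1) =
    2 * count N (\<lambda>p. p m = chain_end p m \<and> leaf p m \<and> p N = k + 1 \<and> p (k + 1) = k \<and> p (k + 2) = k + 1 \<and>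
      \<not> leaf p (k + 2))" (is "count N ?P = 2 * count N ?Q")
proof -
  have "1 * count N ?P = (\<Sum>d\<in>{k+3..<N}. count N (\<lambda>p. ?P p \<and> p d = k + 1))"
  proof (rule sum_count_indexed[symmetric])
    fix p assume p: "p \<in> parent_maps N" "?P p"
    obtain b where b: "b \<noteq> k + 2" "{v. p v = p (k + 2)} = {k + 2, b}"
      using sibling_exists[OF p(1), of "k + 2"] p(2) assms by auto
    then have pb: "p b = k + 1" using p(2) by auto
    then have "b \<noteq> N" using p(2) by auto
    with pb have b_in: "b \<in> {k+3..<N}" using parent_maps_less[OF p(1), of b] p(2) b(1) assms by auto
    have "d = b" if "d \<in> {k+3..<N}" "p d = k + 1" for d
      using no_third_child[OF p(1), of "k + 2" b d] p(2) pb b(1) that by auto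
    then have "{d \<in> {k+3..<N}. p d = k + 1} = {b}" using b_in pb by blast
    then show "card {d \<in> {k+3..<N}. p d = k + 1} = 1" by simp
  qed simp
  also have "\<dots> = (\<Sum>d\<in>{k+3..<N}. count N (\<lambda>p. ?Q p \<and> p d = k + 2))"
    using count_upper_regraft[OF assms] by simp
  also have "\<dots> = 2 * count N ?Q"
  proof (rule sum_count_indexed)
    fix p assume p: "p \<in> parent_maps N" "?Q p"
    then obtain a where "p a = k + 2" by blast
    then have "card {v. p v = k + 2} = 2" by (rule card_fibre[OF p(1), rotated]) simp
    moreover have "d \<in> {k+3..<N}" if "p d = k + 2" for d
      using that parent_maps_less[OF p(1), of d] p(2) by (cases "d = N") auto
    then have "{d \<in> {k+3..<N}. p d = k + 2} = {v. p v = k + 2}" by blast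
    ultimately show "card {d \<in> {k+3..<N}. p d = k + 2} = 2" by simp
  qed simp
  finally show ?thesis by simp
qed

section \<open>Second differences\<close>

text \<open>The trees in which the end of the minimal chain, \<open>m\<close> or
  \<open>m + 1\<close>, is the only one of the two hung at \<open>chain_end p m\<close> cancel by
  the swap. Siblings (\<open>?A\<close>) and parent with child (\<open>?B\<close>) remain.\<close>

lemma tree_count_lower_step:
  assumes "k < m" "2 \<le> m" "m + 1 < N"
  shows "tree_count N (m + 1) k +
      count N (\<lambda>p. p m = chain_end p m \<and> p (m + 1) = chain_end p m \<and> leaf p m \<and> p N = k) =
    tree_count N m k + count N (\<lambda>p. p m = chain_end p m \<and> p (m + 1) = m \<and> leaf p (m + 1) \<and> p N = k)"
    (is "_ + count N ?A = _ + count N ?B")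
proof -
  have "tree_count N (m + 1) k = count N ?B + count N (\<lambda>p. p m \<noteq> chain_end p m \<and>
      p (m + 1) = chain_end p m \<and> leaf p (m + 1) \<and> p N = k)"
    unfolding tree_count_def
    by (subst count_split[where R = "\<lambda>p. p m = chain_end p m"], intro arg_cong2[where f = "(+)"] count_cong) auto
  moreover have "tree_count N m k = count N ?A + count N (\<lambda>p. p m = chain_end p m \<and>
      p (m + 1) \<noteq> chain_end p m \<and> leaf p m \<and> p N = k)"
    unfolding tree_count_def
    by (subst count_split[where R = "\<lambda>p. p (m + 1) = chain_end p m"], intro arg_cong2[where f = "(+)"] count_cong) auto
  ultimately show ?thesis using count_lower_swap[OF assms] by simp
qed

text \<open>The second difference is \<open>B' - B + A - A'\<close>. The rotations give
  \<open>B' - B = B1 - B2 - B3\<close> and \<open>A - A' = A2 - B2\<close>, so with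
  \<open>A2 = B3\<close> it equals \<open>B1 - 2 * B2\<close>. Finally \<open>B1 = 2 * D\<close> and
  \<open>B2 = tree_count N m k + D\<close>.\<close>

lemma tree_count_lower:
  assumes "1 \<le> k" "k < m" "m < N"
  shows "tree_count (N + 2) (m + 2) k + tree_count (N + 2) m k + 2 * tree_count N m k =
    2 * tree_count (N + 2) (m + 1) k"
proof -
  let ?N = "N + 2" and ?e = "\<lambda>p. chain_end p m"
  have m: "k < m" "2 \<le> m" "m + 2 < ?N" using assms by auto
  define A where "A = count ?N (\<lambda>p. p m = ?e p \<and> p (m + 1) = ?e p \<and> leaf p m \<and> p ?N = k)"
  define B where "B = count ?N (\<lambda>p. p m = ?e p \<and> p (m + 1) = m \<and> leaf p (m + 1) \<and> p ?N = k)"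
  define A' where "A' = count ?N (\<lambda>p. p (m + 1) = chain_end p (m + 1) \<and>
      p (m + 1 + 1) = chain_end p (m + 1) \<and> leaf p (m + 1) \<and> p ?N = k)"
  define B' where "B' = count ?N (\<lambda>p. p (m + 1) = chain_end p (m + 1) \<and> p (m + 1 + 1) = m + 1 \<and>
      leaf p (m + 1 + 1) \<and> p ?N = k)"
  define B1 where "B1 = count ?N (\<lambda>p. p m = ?e p \<and> p (m + 1) = m \<and> p (m + 2) = m + 1 \<and>
      leaf p (m + 2) \<and> p ?N = k)"
  define B2 where "B2 = count ?N (\<lambda>p. p m = ?e p \<and> p (m + 1) = m \<and> p (m + 2) = m \<and>
      leaf p (m + 1) \<and> p ?N = k)"
  define B3 where "B3 = count ?N (\<lambda>p. p m = ?e p \<and> p (m + 1) = m \<and> p (m + 2) = ?e p \<and>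
      leaf p (m + 1) \<and> p ?N = k)"
  define A2 where "A2 = count ?N (\<lambda>p. p m = ?e p \<and> p (m + 1) = ?e p \<and> p (m + 2) = m + 1 \<and>
      leaf p m \<and> p ?N = k)"
  define D where "D = count ?N (\<lambda>p. p m = ?e p \<and> p (m + 1) = m \<and> p (m + 2) = m \<and>
      leaf p (m + 1) \<and> \<not> leaf p (m + 2) \<and> p ?N = k)"
  have steps: "tree_count ?N (m + 1) k + A = tree_count ?N m k + B"
    "tree_count ?N (m + 2) k + A' = tree_count ?N (m + 1) k + B'"
    using tree_count_lower_step[of k m ?N] tree_count_lower_step[of k "m + 1" ?N] assms
    unfolding A_def B_def A'_def B'_def by simp_all
  \<comment> \<open>If \<open>m\<close> hangs at \<open>chain_end p m\<close>, then
    \<open>chain_end p (m + 1)\<close> is \<open>m\<close>; otherwise it is still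
    \<open>chain_end p m\<close>.\<close>
  have B': "B' = B1 + count ?N (\<lambda>p. p m \<noteq> ?e p \<and> p (m + 1) = ?e p \<and> p (m + 2) = m + 1 \<and>
      leaf p (m + 2) \<and> p ?N = k)"
    unfolding B'_def B1_def
    by (subst count_split[where R = "\<lambda>p. p m = ?e p"], intro arg_cong2[where f = "(+)"] count_cong)
      (auto simp: numeral_2_eq_2)
  have "B = B2 + count ?N (\<lambda>p. p m = ?e p \<and> p (m + 1) = m \<and> p (m + 2) \<noteq> m \<and> leaf p (m + 1) \<and> p ?N = k)"
    unfolding B_def B2_def
    by (subst count_split[where R = "\<lambda>p. p (m + 2) = m"], intro arg_cong2[where f = "(+)"] count_cong) auto
  also have "count ?N (\<lambda>p. p m = ?e p \<and> p (m + 1) = m \<and> p (m + 2) \<noteq> m \<and> leaf p (m + 1) \<and> p ?N = k) =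
    B3 + count ?N (\<lambda>p. p m = ?e p \<and> p (m + 1) = m \<and> p (m + 2) \<noteq> m \<and> p (m + 2) \<noteq> ?e p \<and>
      leaf p (m + 1) \<and> p ?N = k)"
    unfolding B3_def
  proof (subst count_split[where R = "\<lambda>p. p (m + 2) = ?e p"], intro arg_cong2[where f = "(+)"] count_cong, goal_cases)
    case (1 p)
    then show ?case using chain_end_less[OF 1 m(2)] by auto
  qed auto
  finally have B: "B + B1 = B' + B2 + B3" using B' count_lower_rot_child[OF m] by simp
  have A': "A' = B2 + count ?N (\<lambda>p. p m \<noteq> ?e p \<and> p (m + 1) = ?e p \<and> p (m + 2) = ?e p \<and>
      leaf p (m + 1) \<and> p ?N = k)"
    unfolding A'_def B2_def
    by (subst count_split[where R = "\<lambda>p. p m = ?e p"], intro arg_cong2[where f = "(+)"] count_cong)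
      (auto simp: numeral_2_eq_2)
  have "A = A2 + count ?N (\<lambda>p. p m = ?e p \<and> p (m + 1) = ?e p \<and> p (m + 2) \<noteq> m + 1 \<and>
      p (m + 2) \<noteq> ?e p \<and> leaf p m \<and> p ?N = k)"
    unfolding A_def A2_def
  proof (subst count_split[where R = "\<lambda>p. p (m + 2) = m + 1"], intro arg_cong2[where f = "(+)"] count_cong, goal_cases)
    case (2 p)
    \<comment> \<open>The two children of \<open>chain_end p m\<close> are already \<open>m\<close>
      and \<open>m + 1\<close>.\<close>
    then show ?case using no_third_child[OF 2, of m "m + 1" "m + 2"] parent_maps_inside[OF 2, of m] m by auto
  qed auto
  then have A: "A + B2 = A' + A2" using A' count_lower_rot_sibling[OF m] by simp
  have "A2 = B3" using count_lower_exchange[OF m] unfolding A2_def B3_def by simp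
  moreover have "B1 = 2 * D" using count_lower_double[OF m] unfolding B1_def D_def by simp
  moreover have "B2 = tree_count N m k + D"
    unfolding B2_def D_def count_lower_contract[OF m(1,2) assms(3), symmetric]
    by (subst count_split[where R = "\<lambda>p. leaf p (m + 2)"], intro arg_cong2[where f = "(+)"] count_cong) auto
  ultimately show ?thesis using steps A B by linarith
qed

text \<open>Only the trees with \<open>k + 1\<close> a child of \<open>k\<close> resist the exchange
  of these labels; they form the two correction terms.\<close>

lemma tree_count_upper_step:
  assumes "m < k" "1 \<le> m" "k + 1 < N"
  shows "tree_count N m (k + 1) +
      count N (\<lambda>p. p m = chain_end p m \<and> leaf p m \<and> p N = k \<and> p (k + 1) = k) =
    tree_count N m k + count N (\<lambda>p. p m = chain_end p m \<and> leaf p m \<and> p N = k + 1 \<and> p (k + 1) = k)"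
    (is "_ + count N ?A = _ + count N ?B")
proof -
  have "tree_count N m (k + 1) = count N ?B + count N (\<lambda>p. p m = chain_end p m \<and>
      leaf p m \<and> p N = k + 1 \<and> p (k + 1) \<noteq> k)"
    unfolding tree_count_def
    by (subst count_split[where R = "\<lambda>p. p (k + 1) = k"], intro arg_cong2[where f = "(+)"] count_cong) auto
  moreover have "tree_count N m k = count N ?A + count N (\<lambda>p. p m = chain_end p m \<and>
      leaf p m \<and> p N = k \<and> p (k + 1) \<noteq> k)"
    unfolding tree_count_def
    by (subst count_split[where R = "\<lambda>p. p (k + 1) = k"], intro arg_cong2[where f = "(+)"] count_cong) auto
  ultimately show ?thesis using count_upper_swap[OF assms] by simp
qed

text \<open>Now \<open>B' - B = B1 - A1 - B2\<close> and \<open>A - A' = A2 - A1\<close>. Since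
  \<open>A2 = A1 = B2\<close>, the second difference is \<open>B1 - 2 * A1\<close>, with
  \<open>B1 = 2 * D\<close> and \<open>A1 = tree_count N m k + D\<close>.\<close>

lemma tree_count_upper:
  assumes "1 \<le> m" "m < k" "k < N"
  shows "tree_count (N + 2) m (k + 2) + tree_count (N + 2) m k + 2 * tree_count N m k =
    2 * tree_count (N + 2) m (k + 1)"
proof -
  let ?N = "N + 2" and ?Z = "\<lambda>p. p m = chain_end p m"
  have k: "m < k" "1 \<le> m" "k + 2 < ?N" using assms by auto
  define A where "A = count ?N (\<lambda>p. ?Z p \<and> leaf p m \<and> p ?N = k \<and> p (k + 1) = k)"
  define B where "B = count ?N (\<lambda>p. ?Z p \<and> leaf p m \<and> p ?N = k + 1 \<and> p (k + 1) = k)"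
  define A' where "A' = count ?N (\<lambda>p. ?Z p \<and> leaf p m \<and> p ?N = k + 1 \<and> p (k + 1 + 1) = k + 1)"
  define B' where "B' = count ?N (\<lambda>p. ?Z p \<and> leaf p m \<and> p ?N = k + 1 + 1 \<and> p (k + 1 + 1) = k + 1)"
  define A1 where "A1 = count ?N (\<lambda>p. ?Z p \<and> leaf p m \<and> p ?N = k + 1 \<and> p (k + 1) = k \<and> p (k + 2) = k + 1)"
  define A2 where "A2 = count ?N (\<lambda>p. ?Z p \<and> leaf p m \<and> p ?N = k \<and> p (k + 1) = k \<and> p (k + 2) = k + 1)"
  define B1 where "B1 = count ?N (\<lambda>p. ?Z p \<and> leaf p m \<and> p ?N = k + 2 \<and> p (k + 1) = k \<and> p (k + 2) = k + 1)"
  define B2 where "B2 = count ?N (\<lambda>p. ?Z p \<and> leaf p m \<and> p ?N = k + 1 \<and> p (k + 1) = k \<and> p (k + 2) = k)"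
  define D where "D = count ?N (\<lambda>p. ?Z p \<and> leaf p m \<and> p ?N = k + 1 \<and> p (k + 1) = k \<and> p (k + 2) = k + 1 \<and>
      \<not> leaf p (k + 2))"
  have steps: "tree_count ?N m (k + 1) + A = tree_count ?N m k + B"
    "tree_count ?N m (k + 2) + A' = tree_count ?N m (k + 1) + B'"
    using tree_count_upper_step[of m k ?N] tree_count_upper_step[of m "k + 1" ?N] assms
    unfolding A_def B_def A'_def B'_def by simp_all
  have A': "A' = A1 + count ?N (\<lambda>p. ?Z p \<and> leaf p m \<and> p ?N = k + 1 \<and> p (k + 2) = k + 1 \<and> p (k + 1) \<noteq> k)"
    unfolding A'_def A1_def
    by (subst count_split[where R = "\<lambda>p. p (k + 1) = k"], intro arg_cong2[where f = "(+)"] count_cong) auto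
  have "A = A2 + count ?N (\<lambda>p. ?Z p \<and> leaf p m \<and> p ?N = k \<and> p (k + 1) = k \<and> p (k + 2) \<noteq> k + 1 \<and> p (k + 2) \<noteq> k)"
    unfolding A_def A2_def
  proof (subst count_split[where R = "\<lambda>p. p (k + 2) = k + 1"], intro arg_cong2[where f = "(+)"] count_cong, goal_cases)
    case (2 p)
    then show ?case using no_third_child[OF 2, of "k + 1" ?N "k + 2"] k by auto
  qed auto
  then have A: "A + A1 = A' + A2" using A' count_upper_rot_sibling[OF k] by simp
  have B': "B' = B1 + count ?N (\<lambda>p. ?Z p \<and> leaf p m \<and> p ?N = k + 2 \<and> p (k + 2) = k + 1 \<and> p (k + 1) \<noteq> k)"
    unfolding B'_def B1_def
    by (subst count_split[where R = "\<lambda>p. p (k + 1) = k"], intro arg_cong2[where f = "(+)"] count_cong) auto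
  have "B = A1 + count ?N (\<lambda>p. ?Z p \<and> leaf p m \<and> p ?N = k + 1 \<and> p (k + 1) = k \<and> p (k + 2) \<noteq> k + 1)"
    unfolding B_def A1_def
    by (subst count_split[where R = "\<lambda>p. p (k + 2) = k + 1"], intro arg_cong2[where f = "(+)"] count_cong) auto
  also have "count ?N (\<lambda>p. ?Z p \<and> leaf p m \<and> p ?N = k + 1 \<and> p (k + 1) = k \<and> p (k + 2) \<noteq> k + 1) =
    B2 + count ?N (\<lambda>p. ?Z p \<and> leaf p m \<and> p ?N = k + 1 \<and> p (k + 1) = k \<and> p (k + 2) \<noteq> k + 1 \<and> p (k + 2) \<noteq> k)"
    unfolding B2_def
    by (subst count_split[where R = "\<lambda>p. p (k + 2) = k"], intro arg_cong2[where f = "(+)"] count_cong) auto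
  finally have B: "B + B1 = B' + A1 + B2" using B' count_upper_rot_child[OF k] by simp
  have "A2 = A1" using count_upper_exchange[OF k] unfolding A1_def A2_def by simp
  moreover have "B2 = A1" using count_upper_exchange_top[OF k] unfolding A1_def B2_def by simp
  moreover have "B1 = 2 * D" using count_upper_double[OF k] unfolding B1_def D_def by simp
  moreover have "A1 = tree_count N m k + D"
    unfolding A1_def D_def count_upper_contract[OF k(1,2) assms(3), symmetric]
    by (subst count_split[where R = "\<lambda>p. leaf p (k + 2)"], intro arg_cong2[where f = "(+)"] count_cong) auto
  ultimately show ?thesis using steps A B by linarith
qed

section \<open>Border rows and columns\<close>

text \<open>The sibling of \<open>N\<close> has to fit strictly between the parent of
  \<open>N\<close> and \<open>N\<close>.\<close>

lemma parent_of_max: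
  assumes "p \<in> parent_maps N" "N \<ge> 2"
  shows "p N + 1 < N"
proof -
  have "1 \<le> p N" "p N < N" using parent_maps_inside[OF assms(1), of N] assms(2) by auto
  moreover obtain b where "b \<noteq> N" "{v. p v = p N} = {N, b}"
    using sibling_exists[OF assms(1), of N] \<open>1 \<le> p N\<close> by auto
  then have "p b = p N" by auto
  ultimately show ?thesis using parent_maps_less[OF assms(1), of b] \<open>b \<noteq> N\<close> by auto
qed

lemma leaf_max:
  assumes "p \<in> parent_maps N" "u \<ge> N" "u \<ge> 1"
  shows "leaf p u"
proof
  fix v
  show "p v \<noteq> u" using parent_maps_less[OF assms(1), of v] assms(2,3) by (cases "p v = 0") auto
qed

text \<open>The chain end has no earlier child, so \<open>a\<close> is its first one and the sibling
  is larger.\<close>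

lemma chain_child_sibling:
  assumes "p \<in> parent_maps N" "p a = chain_end p a" "2 \<le> a"
  obtains b where "a < b" "b \<le> N" "p b = p a"
proof -
  have nz: "p a \<noteq> 0" using chain_end_pos[OF assms(1), of a] assms(2) by simp
  obtain b where b: "b \<noteq> a" "{v. p v = p a} = {a, b}" using sibling_exists[OF assms(1) nz] .
  then have pb: "p b = p a" by auto
  then have "\<not> b < a" using chain_end_childless[OF assms(1), of b a] assms(2) by auto
  then show thesis using that[of b] b(1) pb parent_maps_less[OF assms(1), of b] nz by auto
qed

lemma tree_count_diagonal: "tree_count N m m = 0"
  unfolding tree_count_def by (rule count_eq_0) auto

lemma tree_count_last_column:
  assumes "2 \<le> N"
  shows "tree_count N m (N - 1) = 0"
  unfolding tree_count_def
proof (rule count_eq_0)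
  fix p assume "p \<in> parent_maps N"
  from parent_of_max[OF this assms]
  show "\<not> (p m = chain_end p m \<and> leaf p m \<and> p N = N - 1)" by auto
qed

text \<open>The sibling of \<open>N + 1\<close> could only be \<open>N + 2\<close>, so both would be
  children of \<open>N\<close>. Then \<open>N\<close> lies on the minimal chain and needs a larger
  sibling, but the larger labels are its own children.\<close>

lemma tree_count_corner:
  assumes "2 \<le> N"
  shows "tree_count (N + 2) (N + 1) N = 0"
  unfolding tree_count_def
proof (rule count_eq_0, rule notI)
  fix p assume p: "p \<in> parent_maps (N + 2)"
    and e: "p (N + 1) = chain_end p (N + 1) \<and> leaf p (N + 1) \<and> p (N + 2) = N"
  have "N + 1 \<ge> 2" using assms by simp
  then obtain b where b: "N + 1 < b" "b \<le> N + 2" "p b = p (N + 1)"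
    using chain_child_sibling[OF p, of "N + 1"] e by metis
  then have "b = N + 2" by simp
  then have pN: "p (N + 1) = N" using e b(3) by simp
  then have "chain_end p (Suc N) = N" using e by simp
  then have "p N = chain_end p N" using chain_end_eq_iff[OF p, of "Suc N" N] assms by simp
  then obtain c where c: "N < c" "c \<le> N + 2" "p c = p N"
    using chain_child_sibling[OF p, of N] assms by metis
  have "c = N + 1 \<or> c = N + 2" using c by auto
  then have "p c = N" using pN e by auto
  then show False using c parent_maps_inside[OF p, of N] assms by auto
qed

text \<open>Only \<open>N + 1\<close> can be the sibling of \<open>N + 2\<close> below
  \<open>N\<close>. Deleting both leaves an arbitrary tree, whose top label is a leaf
  anyway.\<close>

lemma tree_count_column:
  assumes "1 \<le> m" "m < N"
  shows "tree_count (N + 2) m N = count N (\<lambda>p. p m = chain_end p m \<and> leaf p m)"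
proof -
  have "tree_count (N + 2) m N = count (N + 2) (\<lambda>p. p (N + 1) = N \<and> p (N + 2) = N \<and>
      (p m = chain_end p m \<and> (\<forall>v\<le>N. p v \<noteq> m)))"
    unfolding tree_count_def
  proof (rule count_cong)
    fix p assume p: "p \<in> parent_maps (N + 2)"
    have "p (N + 1) = N" if N: "p (N + 2) = N"
    proof -
      obtain b where b: "b \<noteq> N + 2" "{v. p v = p (N + 2)} = {N + 2, b}"
        using sibling_exists[OF p, of "N + 2"] N assms by auto
      then have pb: "p b = N" using N by auto
      then have "b = N + 1" using parent_maps_less[OF p, of b] b(1) assms by auto
      then show ?thesis using pb by simp
    qed
    moreover have "leaf p m" if "p (N + 1) = N" "p (N + 2) = N" "\<forall>v\<le>N. p v \<noteq> m"
    proof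
      fix v
      have "v \<le> N \<or> v = N + 1 \<or> v = N + 2 \<or> v \<notin> {2..N + 2}" by auto
      then show "p v \<noteq> m" using that parent_maps_outside[OF p, of v] assms by fastforce
    qed
    ultimately show "(p m = chain_end p m \<and> leaf p m \<and> p (N + 2) = N) =
      (p (N + 1) = N \<and> p (N + 2) = N \<and> p m = chain_end p m \<and> (\<forall>v\<le>N. p v \<noteq> m))" by blast
  qed
  also have "\<dots> = count N (\<lambda>p. leaf p N \<and> (p m = chain_end p m \<and> (\<forall>v\<le>N. p v \<noteq> m)))"
  proof (rule count_insert_top[where h = "\<lambda>_. N"
        and R = "\<lambda>p. p m = chain_end p m \<and> (\<forall>v\<le>N. p v \<noteq> m)"], goal_cases)
    case (1 p q)
    then show ?case using assms chain_end_cong[of m p q] by auto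
  qed (use assms in auto)
  also have "\<dots> = count N (\<lambda>p. p m = chain_end p m \<and> leaf p m)"
  proof (rule count_cong)
    fix p assume p: "p \<in> parent_maps N"
    have "p v \<noteq> m" if "v > N" for v using parent_maps_outside[OF p, of v] that assms by auto
    then show "(leaf p N \<and> p m = chain_end p m \<and> (\<forall>v\<le>N. p v \<noteq> m)) =
      (p m = chain_end p m \<and> leaf p m)" using leaf_max[OF p, of N] assms by (metis le_refl le_trans less_imp_le not_le)
  qed
  finally show ?thesis .
qed

text \<open>The two top labels hang at the end of the minimal chain of the first \<open>N\<close>
  labels; once they are removed, that vertex is automatically a leaf.\<close>

lemma count_top_pair_at_chain_end:
  assumes "2 \<le> N"
  shows "count (N + 2) (\<lambda>p. p (N + 1) = chain_end p (N + 1) \<and> p (N + 2) = chain_end p (N + 1) \<and> chain_end p (N + 1) = k) =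
    count N (\<lambda>p. p k = chain_end p k \<and> leaf p k)"
proof -
  have "count (N + 2) (\<lambda>p. p (N + 1) = chain_end p (N + 1) \<and> p (N + 2) = chain_end p (N + 1) \<and> chain_end p (N + 1) = k) =
    count N (\<lambda>p. leaf p (chain_end p (N + 1)) \<and> chain_end p (N + 1) = k)"
  proof (rule count_insert_top, goal_cases)
    case (1 p q)
    then show ?case using chain_end_cong[of "N + 1" p q] by simp
  next
    case (2 q)
    then show ?case using chain_end_pos[OF 2(1), of "N + 1"] chain_end_less[OF 2(1), of "N + 1"] assms by simp
  qed (use assms in auto)
  also have "\<dots> = count N (\<lambda>p. p k = chain_end p k \<and> leaf p k)"
  proof (rule count_cong)
    fix p assume p: "p \<in> parent_maps N"
    show "(leaf p (chain_end p (N + 1)) \<and> chain_end p (N + 1) = k) = (p k = chain_end p k \<and> leaf p k)"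
      using chain_end_total[OF p assms, of k] by (metis Suc_eq_plus1)
  qed
  finally show ?thesis .
qed

text \<open>The later sibling of \<open>N + 1\<close> must be \<open>N + 2\<close>, so
  \<open>k\<close> is the chain end of the tree without these two.\<close>

lemma tree_count_last_row:
  assumes "2 \<le> N" "1 \<le> k" "k < N"
  shows "tree_count (N + 2) (N + 1) k = count N (\<lambda>p. p k = chain_end p k \<and> leaf p k)"
  unfolding count_top_pair_at_chain_end[OF assms(1), symmetric] tree_count_def
proof (rule count_cong)
  fix p assume p: "p \<in> parent_maps (N + 2)"
  have "p (N + 2) = chain_end p (N + 1)" if e: "p (N + 1) = chain_end p (N + 1)"
  proof -
    have "N + 1 \<ge> 2" using assms by simp
    then obtain b where b: "N + 1 < b" "b \<le> N + 2" "p b = p (N + 1)"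
      using chain_child_sibling[OF p e] by metis
    then have "b = N + 2" by simp
    then show ?thesis using b(3) e by simp
  qed
  moreover have "leaf p (N + 1)" if "p (N + 2) = k"
  proof
    fix v
    show "p v \<noteq> N + 1" using parent_maps_less[OF p, of v] that assms by (cases "v = N + 2") auto
  qed
  ultimately show "(p (N + 1) = chain_end p (N + 1) \<and> leaf p (N + 1) \<and> p (N + 2) = k) =
    (p (N + 1) = chain_end p (N + 1) \<and> p (N + 2) = chain_end p (N + 1) \<and> chain_end p (N + 1) = k)" by metis
qed

text \<open>On both sides \<open>N\<close> and \<open>N + 1\<close> are leaves, so they may trade
  parents. Afterwards \<open>N\<close> no longer hangs at \<open>k\<close>, and \<open>k\<close> is
  still the chain end below \<open>N + 1\<close>.\<close>

lemma count_penultimate_row_split: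
  assumes "2 \<le> N" "1 \<le> k" "k < N"
  shows "count (N + 2) (\<lambda>p. p N = chain_end p N \<and> p (N + 2) = chain_end p N \<and> chain_end p N = k \<and> p (N + 1) \<noteq> k \<and> p (N + 1) \<noteq> N) =
    count (N + 2) (\<lambda>p. p (N + 1) = chain_end p N \<and> p (N + 2) = chain_end p N \<and> chain_end p N = k \<and> p N \<noteq> k)"
proof (rule count_transform[where \<sigma> = "\<lambda>x. x" and \<sigma>' = "\<lambda>x. x" and \<tau> = "transpose N (N + 1)"
      and \<tau>' = "transpose N (N + 1)" and s = N], goal_cases)
  case (8 p w)
  then show ?case using assms parent_maps_inside[OF 8(1), of "N + 1"] by (auto simp: transpose_def)
next
  case (9 p w)
  then show ?case using assms parent_maps_inside[OF 9(1), of "N"] by (auto simp: transpose_def)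
next
  case (10 p q)
  then show ?case using assms by (auto simp: transpose_def)
next
  case (11 p q)
  then show ?case using assms parent_maps_inside[OF 11(1), of "N"] by (auto simp: transpose_def)
qed (use assms in \<open>auto simp: transpose_def split: if_splits\<close>)

lemma count_penultimate_row_pair:
  assumes "2 \<le> N" "1 \<le> k" "k < N"
  shows "count (N + 2) (\<lambda>p. p N = chain_end p N \<and> p (N + 1) = chain_end p N \<and> p (N + 2) = k \<and> k \<noteq> chain_end p N) =
    count (N + 2) (\<lambda>p. p (N + 1) = chain_end p N \<and> p (N + 2) = chain_end p N \<and> p N = k \<and> k \<noteq> chain_end p N)"
proof (rule count_transform[where \<sigma> = "\<lambda>x. x" and \<sigma>' = "\<lambda>x. x" and \<tau> = "transpose N (N + 2)"
      and \<tau>' = "transpose N (N + 2)" and s = N], goal_cases)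
  case (8 p w)
  then show ?case using assms chain_end_less[OF 8(1) assms(1)] by (auto simp: transpose_def)
next
  case (9 p w)
  then show ?case using assms chain_end_less[OF 9(1) assms(1)] by (auto simp: transpose_def)
next
  case (10 p q)
  then show ?case using assms by (auto simp: transpose_def)
next
  case (11 p q)
  then show ?case using assms by (auto simp: transpose_def)
qed (use assms in \<open>auto simp: transpose_def split: if_splits\<close>)

text \<open>The later sibling of \<open>N\<close> is \<open>N + 2\<close> or \<open>N + 1\<close>.
  In the first case \<open>k\<close> is the chain end, which gives the row sum. In the second
  \<open>N + 2\<close> hangs at another vertex \<open>k\<close>; after trading it with
  \<open>N\<close>, deletion of the top pair gives the column sum.\<close>

lemma tree_count_penultimate_row:
  assumes "2 \<le> N" "1 \<le> k" "k < N"
  shows "tree_count (N + 2) N k =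
    count N (\<lambda>p. p k = chain_end p k \<and> leaf p k) + count N (\<lambda>p. p N = k)"
proof -
  have "tree_count (N + 2) N k =
    count (N + 2) (\<lambda>p. p N = chain_end p N \<and> p (N + 2) = chain_end p N \<and> chain_end p N = k \<and> p (N + 1) \<noteq> k \<and> p (N + 1) \<noteq> N) +
    count (N + 2) (\<lambda>p. p N = chain_end p N \<and> p (N + 1) = chain_end p N \<and> p (N + 2) = k \<and> k \<noteq> chain_end p N)"
    unfolding tree_count_def
  proof (subst count_split[where R = "\<lambda>p. p (N + 1) \<noteq> chain_end p N"], intro arg_cong2[where f = "(+)"] count_cong, goal_cases)
    case (1 p)
    have "p (N + 2) = chain_end p N" if e: "p N = chain_end p N" "p (N + 1) \<noteq> chain_end p N"
    proof -
      obtain b where b: "N < b" "b \<le> N + 2" "p b = p N"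
        using chain_child_sibling[OF 1 e(1) assms(1)] by metis
      then have "b \<noteq> N + 1" using e by auto
      then have "b = N + 2" using b by simp
      then show ?thesis using b(3) e by simp
    qed
    moreover have "leaf p N" if "p (N + 1) \<noteq> N" "p (N + 2) = k"
    proof
      fix v
      have "v = N + 1 \<or> v = N + 2 \<or> p v \<noteq> N"
        using parent_maps_less[OF 1, of v] assms by auto
      then show "p v \<noteq> N" using that assms by auto
    qed
    ultimately show ?case by metis
  next
    case (2 p)
    have less: "chain_end p N < N" by (rule chain_end_less[OF 2 assms(1)])
    have "p (N + 2) \<noteq> chain_end p N" if "p N = chain_end p N" "p (N + 1) = chain_end p N"
      using no_third_child[OF 2, of N "N + 1" "N + 2"] that chain_end_pos[OF 2, of N] by auto
    moreover have "leaf p N" if "p (N + 1) = chain_end p N" "p (N + 2) = k"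
    proof
      fix v
      have "v = N + 1 \<or> v = N + 2 \<or> p v \<noteq> N"
        using parent_maps_less[OF 2, of v] assms by auto
      then show "p v \<noteq> N" using that assms less by auto
    qed
    ultimately show ?case by metis
  qed
  also have "count (N + 2) (\<lambda>p. p N = chain_end p N \<and> p (N + 2) = chain_end p N \<and> chain_end p N = k \<and> p (N + 1) \<noteq> k \<and> p (N + 1) \<noteq> N) =
    count N (\<lambda>p. p k = chain_end p k \<and> leaf p k)"
    unfolding count_penultimate_row_split[OF assms] count_top_pair_at_chain_end[OF assms(1), symmetric]
    by (rule count_cong) (use assms in auto)
  also have "count (N + 2) (\<lambda>p. p N = chain_end p N \<and> p (N + 1) = chain_end p N \<and> p (N + 2) = k \<and> k \<noteq> chain_end p N) =
    count (N + 2) (\<lambda>p. p (N + 1) = chain_end p (N + 1) \<and> p (N + 2) = chain_end p (N + 1) \<and> p N = k)"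
    unfolding count_penultimate_row_pair[OF assms]
  proof (rule count_cong)
    fix p assume p: "p \<in> parent_maps (N + 2)"
    show "(p (N + 1) = chain_end p N \<and> p (N + 2) = chain_end p N \<and> p N = k \<and> k \<noteq> chain_end p N) =
      (p (N + 1) = chain_end p (N + 1) \<and> p (N + 2) = chain_end p (N + 1) \<and> p N = k)"
    proof (cases "p N = chain_end p N")
      \<comment> \<open>Both sides fail: \<open>N\<close> would be the chain end below
        \<open>N + 1\<close>, but its sibling \<open>N + 1\<close> or \<open>N + 2\<close> hangs at
        \<open>p N < N\<close>.\<close>
      case True
      obtain b where b: "N < b" "b \<le> N + 2" "p b = p N"
        using chain_child_sibling[OF p True assms(1)] by metis
      then have "b = N + 1 \<or> b = N + 2" by auto
      moreover have "p N < N" using parent_maps_inside[OF p, of N] assms by simp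
      ultimately show ?thesis using True b(3) by auto
    qed auto
  qed
  also have "\<dots> = count N (\<lambda>p. leaf p (chain_end p (N + 1)) \<and> p N = k)"
  proof (rule count_insert_top, goal_cases)
    case (1 p q)
    then show ?case using chain_end_cong[of "N + 1" p q] by simp
  next
    case (2 q)
    then show ?case using chain_end_pos[OF 2(1), of "N + 1"] chain_end_less[OF 2(1), of "N + 1"] assms by simp
  qed (use assms in auto)
  also have "\<dots> = count N (\<lambda>p. p N = k)"
  proof (rule count_cong)
    fix p assume p: "p \<in> parent_maps N"
    show "(leaf p (chain_end p (N + 1)) \<and> p N = k) = (p N = k)"
      using chain_end_total[OF p assms(1), of "chain_end p (N + 1)"] by auto
  qed
  finally show ?thesis .
qed

lemma sum_tree_count_row:
  assumes "2 \<le> N"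
  shows "(\<Sum>k = 1..N - 1. tree_count N m k) = count N (\<lambda>p. p m = chain_end p m \<and> leaf p m)"
proof -
  have "(\<Sum>k = 1..N - 1. count N (\<lambda>p. (p m = chain_end p m \<and> leaf p m) \<and> p N = k)) =
    1 * count N (\<lambda>p. p m = chain_end p m \<and> leaf p m)"
  proof (rule sum_count_indexed)
    fix p assume p: "p \<in> parent_maps N"
    have "{k \<in> {1..N - 1}. p N = k} = {p N}" using parent_maps_inside[OF p, of N] assms by auto
    then show "card {k \<in> {1..N - 1}. p N = k} = 1" by simp
  qed simp
  then show ?thesis unfolding tree_count_def by simp
qed

text \<open>Each tree has one chain end, and it is not \<open>N\<close>, which would need a larger
  sibling; hence the range up to \<open>N - 1\<close> suffices.\<close>

lemma sum_tree_count_column: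
  assumes "2 \<le> N"
  shows "(\<Sum>m = 1..N - 1. tree_count N m k) = count N (\<lambda>p. p N = k)"
proof -
  have "(\<Sum>m = 1..N - 1. count N (\<lambda>p. p N = k \<and> (p m = chain_end p m \<and> leaf p m))) =
    1 * count N (\<lambda>p. p N = k)"
  proof (rule sum_count_indexed)
    fix p assume p: "p \<in> parent_maps N"
    let ?c = "chain_end p (Suc N)"
    have "?c \<noteq> N"
    proof
      assume "?c = N"
      then have "p N = chain_end p N" using chain_end_total[OF p assms, of N] by simp
      then obtain b where "N < b" "b \<le> N" using chain_child_sibling[OF p _ assms] by metis
      then show False by simp
    qed
    then have "1 \<le> ?c" "?c \<le> N - 1"
      using chain_end_pos[OF p, of "Suc N"] chain_end_less[OF p, of "Suc N"] assms by linarith+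
    then have "{m \<in> {1..N - 1}. ?c = m} = {?c}" by (auto simp del: chain_end.simps)
    then show "card {m \<in> {1..N - 1}. p m = chain_end p m \<and> leaf p m} = 1"
      by (simp add: chain_end_total[OF p assms, symmetric] del: chain_end.simps)
  qed simp
  moreover have "tree_count N m k = count N (\<lambda>p. p N = k \<and> (p m = chain_end p m \<and> leaf p m))" for m
    unfolding tree_count_def by (rule count_cong) auto
  ultimately show ?thesis by simp
qed

lemma tree_count_base: "tree_count 3 2 1 = 1"
proof -
  let ?p = "\<lambda>v::nat. if v = 2 \<or> v = 3 then 1 else 0 :: nat"
  have "{v. ?p v = u} = (if u = 1 then {2, 3} else {})" if "u \<ge> 1" for u using that by auto
  then have "?p \<in> parent_maps 3" unfolding parent_maps_def by auto
  moreover have "p = ?p" if p: "p \<in> parent_maps 3" for p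
  proof
    fix v
    have "p 2 = 1" "p 3 = 1"
      using parent_maps_inside[OF p, of 2] parent_maps_inside[OF p, of 3] parent_of_max[OF p] by auto
    then show "p v = ?p v" using parent_maps_outside[OF p, of v] by (cases "v = 2 \<or> v = 3") auto
  qed
  moreover have "?p 2 = chain_end ?p 2 \<and> leaf ?p 2 \<and> ?p 3 = 1" by (simp add: numeral_2_eq_2)
  ultimately have "{p \<in> parent_maps 3. p 2 = chain_end p 2 \<and> leaf p 2 \<and> p 3 = 1} = {?p}" by blast
  then show ?thesis unfolding tree_count_def count_def by simp
qed

section \<open>The Delta sequence\<close>

definition tree_matrix :: "nat \<Rightarrow> nat \<Rightarrow> nat \<Rightarrow> nat" where
  "tree_matrix n m k = (if (m, k) \<in> {1..2*n} \<times> {1..2*n} then tree_count (2*n+1) m k else 0)"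

lemma tree_count_root: "tree_count N 1 k = 0"
  unfolding tree_count_def
proof (rule count_eq_0)
  fix p assume p: "p \<in> parent_maps N"
  show "\<not> (p 1 = chain_end p 1 \<and> leaf p 1 \<and> p N = k)"
    using parent_maps_outside[OF p, of 1] chain_end_pos[OF p, of 1] by auto
qed

lemma row_sum_tree_matrix:
  assumes "1 \<le> n" "m \<in> {1..2*n}"
  shows "row_sum tree_matrix n m = count (2*n+1) (\<lambda>p. p m = chain_end p m \<and> leaf p m)"
  using sum_tree_count_row[of "2*n+1" m] assms by (simp add: row_sum_def tree_matrix_def)

lemma col_sum_tree_matrix:
  assumes "1 \<le> n" "k \<in> {1..2*n}"
  shows "col_sum tree_matrix n k = count (2*n+1) (\<lambda>p. p (2*n+1) = k)"
  using sum_tree_count_column[of "2*n+1" k] assms by (simp add: col_sum_def tree_matrix_def)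

lemma delta_conditions_tree_matrix: "delta_conditions tree_matrix"
proof -
  let ?g = tree_matrix
  have base: "?g 1 1 1 = 0 \<and> ?g 1 1 2 = 0 \<and> ?g 1 2 1 = 1 \<and> ?g 1 2 2 = 0"
    using tree_count_root[of 3] tree_count_base tree_count_diagonal[of 3 2]
    by (simp add: tree_matrix_def)
  have step: "(\<forall>m\<in>{1..2*n}. ?g n m m = 0) \<and>
        (\<forall>(m, k)\<in>L1 n. int (?g n (m+2) k) - 2 * int (?g n (m+1) k) + int (?g n m k)
                          + 2 * int (?g (n-1) m k) = 0) \<and>
        (\<forall>(m, k)\<in>U1 n. int (?g n m (k+2)) - 2 * int (?g n m (k+1)) + int (?g n m k)
                          + 2 * int (?g (n-1) m k) = 0) \<and>
        (\<forall>m\<in>{1..2*n}. ?g n m (2*n) = 0) \<and>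
        (\<forall>m\<in>{1..2*n-2}. ?g n m (2*n-1) = row_sum ?g (n-1) m) \<and>
        ?g n (2*n-1) (2*n-1) = 0 \<and> ?g n (2*n) (2*n-1) = 0 \<and>
        (\<forall>k\<in>{1..2*n-2}. ?g n (2*n) k = row_sum ?g (n-1) k) \<and>
        ?g n (2*n) (2*n-1) = 0 \<and> ?g n (2*n) (2*n) = 0 \<and>
        (\<forall>k\<in>{1..2*n-2}. ?g n (2*n-1) k = row_sum ?g (n-1) k + col_sum ?g (n-1) k) \<and>
        ?g n (2*n-1) (2*n-1) = 0 \<and> ?g n (2*n-1) (2*n) = 0" if n: "n \<ge> 2" for n
  proof -
    define n' where "n' = n - 1"
    have n': "n = n' + 1" "n' \<ge> 1" using n by (auto simp: n'_def)
    \<comment> \<open>The matrix of index \<open>n'\<close> counts trees on \<open>?N\<close>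
      vertices, that of index \<open>n\<close> trees on \<open>?N + 2\<close>.\<close>
    let ?N = "2*n' + 1"
    have N: "2*n + 1 = ?N + 2" "2*n = ?N + 1" "2*n - 1 = ?N" "2*n - 2 = 2*n'" "n - 1 = n'" "2 \<le> ?N"
      using n' by auto
    have g: "?g n m k = tree_count (?N + 2) m k" if "1 \<le> m" "m \<le> ?N + 1" "1 \<le> k" "k \<le> ?N + 1" for m k
      using that n' by (simp add: tree_matrix_def)
    have g': "?g n' m k = tree_count ?N m k" if "1 \<le> m" "m \<le> 2*n'" "1 \<le> k" "k \<le> 2*n'" for m k
      using that by (simp add: tree_matrix_def)
    have diag: "?g n m m = 0" for m by (simp add: tree_matrix_def tree_count_diagonal)
    have low: "int (?g n (m+2) k) - 2 * int (?g n (m+1) k) + int (?g n m k) + 2 * int (?g n' m k) = 0"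
      if "(m, k) \<in> L1 n" for m k
    proof -
      have mk: "1 \<le> k" "k < m" "m \<le> 2*n'" using that N unfolding L1_def by auto
      then have "tree_count (?N + 2) (m + 2) k + tree_count (?N + 2) m k + 2 * tree_count ?N m k =
        2 * tree_count (?N + 2) (m + 1) k" by (intro tree_count_lower) auto
      then show ?thesis using mk g[of "m + 2" k] g[of "m + 1" k] g[of m k] g'[of m k] by simp
    qed
    have up: "int (?g n m (k+2)) - 2 * int (?g n m (k+1)) + int (?g n m k) + 2 * int (?g n' m k) = 0"
      if "(m, k) \<in> U1 n" for m k
    proof -
      have mk: "1 \<le> m" "m < k" "k \<le> 2*n'" using that N unfolding U1_def by auto
      then have "tree_count (?N + 2) m (k + 2) + tree_count (?N + 2) m k + 2 * tree_count ?N m k =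
        2 * tree_count (?N + 2) m (k + 1)" by (intro tree_count_upper) auto
      then show ?thesis using mk g[of m "k + 2"] g[of m "k + 1"] g[of m k] g'[of m k] by simp
    qed
    have last_col: "?g n m (?N + 1) = 0" for m
      using tree_count_last_column[of "?N + 2" m] N by (simp add: tree_matrix_def)
    have col: "?g n m ?N = row_sum ?g n' m" if "m \<in> {1..2*n'}" for m
      using g[of m ?N] tree_count_column[of m ?N] row_sum_tree_matrix[OF n'(2) that] that by simp
    have corner: "?g n (?N + 1) ?N = 0" using g[of "?N + 1" ?N] tree_count_corner[OF N(6)] by simp
    have row: "?g n (?N + 1) k = row_sum ?g n' k" if "k \<in> {1..2*n'}" for k
      using g[of "?N + 1" k] tree_count_last_row[OF N(6), of k] row_sum_tree_matrix[OF n'(2) that] that by simp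
    have row': "?g n ?N k = row_sum ?g n' k + col_sum ?g n' k" if "k \<in> {1..2*n'}" for k
      using g[of ?N k] tree_count_penultimate_row[OF N(6), of k] row_sum_tree_matrix[OF n'(2) that]
        col_sum_tree_matrix[OF n'(2) that] that by simp
    show ?thesis unfolding N(3-5) unfolding N(2)
      using diag low up last_col col corner row row' by blast
  qed
  show ?thesis unfolding delta_conditions_def
    using base step by (intro conjI) (auto simp: tree_matrix_def)
qed

section \<open>Uniqueness of the Delta sequence\<close>

lemma delta_conditions_unique:
  assumes f: "delta_conditions f" and g: "delta_conditions g"
  shows "f = g"
proof -
  have "f n = g n" for n
  proof (induction n rule: less_induct)
    case (less n)
    have out: "f n m k = g n m k" if "(m, k) \<notin> {1..2*n} \<times> {1..2*n}" for m k
      using f g that unfolding delta_conditions_def by metis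
    consider "n = 0" | "n = 1" | "n \<ge> 2" by linarith
    then show ?case
    proof cases
      case 1
      then show ?thesis using out by (intro ext) auto
    next
      case 2
      have "f n m k = g n m k" if "(m, k) \<in> {1..2*n} \<times> {1..2*n}" for m k
      proof -
        have "m = 1 \<or> m = 2" "k = 1 \<or> k = 2" using that 2 by auto
        then show ?thesis using f g 2 unfolding delta_conditions_def by metis
      qed
      then show ?thesis using out by (intro ext) blast
    next
      case 3
      have IH: "f (n - 1) = g (n - 1)" using less.IH[of "n - 1"] 3 by simp
      have rs: "row_sum f (n - 1) m = row_sum g (n - 1) m" "col_sum f (n - 1) m = col_sum g (n - 1) m" for m
        unfolding row_sum_def col_sum_def IH by simp_all
      have conds: "(\<forall>m\<in>{1..2*n}. h n m m = 0)"
        "(\<forall>(m, k)\<in>L1 n. int (h n (m+2) k) - 2 * int (h n (m+1) k) + int (h n m k)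
                          + 2 * int (h (n-1) m k) = 0)"
        "(\<forall>(m, k)\<in>U1 n. int (h n m (k+2)) - 2 * int (h n m (k+1)) + int (h n m k)
                          + 2 * int (h (n-1) m k) = 0)"
        "(\<forall>m\<in>{1..2*n}. h n m (2*n) = 0)"
        "(\<forall>m\<in>{1..2*n-2}. h n m (2*n-1) = row_sum h (n-1) m)"
        "h n (2*n-1) (2*n-1) = 0" "h n (2*n) (2*n-1) = 0"
        "(\<forall>k\<in>{1..2*n-2}. h n (2*n) k = row_sum h (n-1) k)"
        "(\<forall>k\<in>{1..2*n-2}. h n (2*n-1) k = row_sum h (n-1) k + col_sum h (n-1) k)"
        if "delta_conditions h" for h
        using that 3 unfolding delta_conditions_def by blast+
      note cf = conds[OF f] and cg = conds[OF g]
      \<comment> \<open>The previous matrix gives the rows \<open>2*n\<close> and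
        \<open>2*n - 1\<close>; the recurrence then determines each entry from the two beneath
        it.\<close>
      have lower: "f n m k = g n m k" if "1 \<le> k" "k < m" "m \<le> 2*n" for m k
        using that
      proof (induction "2*n - m" arbitrary: m rule: less_induct)
        case (less m)
        consider "m = 2*n" "k = 2*n - 1" | "m = 2*n" "k \<le> 2*n - 2" | "m = 2*n - 1" "k \<le> 2*n - 2"
          | "m \<le> 2*n - 2" using less.prems by linarith
        then show ?case
        proof cases
          case 4
          have mk: "(m, k) \<in> L1 n" using 4 less.prems unfolding L1_def by auto
          have "f n (m + 1) k = g n (m + 1) k" "f n (m + 2) k = g n (m + 2) k"
            using less.hyps[of "m + 1"] less.hyps[of "m + 2"] less.prems 4 3 by auto
          then show ?thesis using bspec[OF cf(2) mk] bspec[OF cg(2) mk] IH by simp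
        qed (use cf cg rs less.prems in auto)
      qed
      \<comment> \<open>Here the recurrence runs leftwards from the last two columns.\<close>
      have upper: "f n m k = g n m k" if "1 \<le> m" "m < k" "k \<le> 2*n" for m k
        using that
      proof (induction "2*n - k" arbitrary: k rule: less_induct)
        case (less k)
        consider "k = 2*n" | "k = 2*n - 1" | "k \<le> 2*n - 2" using less.prems by linarith
        then show ?case
        proof cases
          case 3
          have mk: "(m, k) \<in> U1 n" using 3 less.prems unfolding U1_def by auto
          have "f n m (k + 1) = g n m (k + 1)" "f n m (k + 2) = g n m (k + 2)"
            using less.hyps[of "k + 1"] less.hyps[of "k + 2"] less.prems 3 \<open>n \<ge> 2\<close> by auto
          then show ?thesis using bspec[OF cf(3) mk] bspec[OF cg(3) mk] IH by simp
        qed (use cf cg rs less.prems in auto)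
      qed
      have "f n m k = g n m k" if "(m, k) \<in> {1..2*n} \<times> {1..2*n}" for m k
      proof (cases "m = k")
        case True
        then show ?thesis using cf(1) cg(1) that by auto
      next
        case False
        then show ?thesis using lower[of k m] upper[of m k] that by fastforce
      qed
      then show ?thesis using out by (intro ext) blast
    qed
  qed
  then show ?thesis by blast
qed

lemma Delta_eq_tree_matrix: "Delta = tree_matrix"
  unfolding Delta_def
  by (rule the_equality) (use delta_conditions_tree_matrix delta_conditions_unique in auto)

section \<open>Trees as edge sets\<close>

definition edges :: "nat \<Rightarrow> (nat \<Rightarrow> nat) \<Rightarrow> (nat \<times> nat) set" where
  "edges N p = {(p v, v) | v. v \<in> {2..N}}"

lemma edges_iff: "(u, v) \<in> edges N p \<longleftrightarrow> v \<in> {2..N} \<and> u = p v"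
  by (auto simp: edges_def)

lemma edges_children:
  assumes "p \<in> parent_maps N" "u \<ge> 1"
  shows "edges N p `` {u} = {v. p v = u}"
  using parent_maps_less[OF assms(1)] assms(2) by (fastforce simp: edges_iff Image_singleton_iff)

lemma edges_tree:
  assumes p: "p \<in> parent_maps N" and "N \<ge> 1"
  shows "edges N p \<in> strictly_ordered_binary_trees N"
proof -
  have reach: "(1, v) \<in> (edges N p)\<^sup>*" if "v \<in> {1..N}" for v
    using that
  proof (induction v rule: less_induct)
    case (less v)
    show ?case
    proof (cases "v = 1")
      case False
      then have v: "v \<in> {2..N}" using less.prems by auto
      then have "1 \<le> p v" "p v < v" using parent_maps_inside[OF p v] by auto
      then have "(1, p v) \<in> (edges N p)\<^sup>*" using less v by auto
      moreover have "(p v, v) \<in> edges N p" using v by (simp add: edges_iff)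
      ultimately show ?thesis by (rule rtrancl_into_rtrancl)
    qed simp
  qed
  have sub: "edges N p \<subseteq> {1..N} \<times> {1..N}"
  proof clarify
    fix u v assume "(u, v) \<in> edges N p"
    then have v: "v \<in> {2..N}" "u = p v" by (auto simp: edges_iff)
    then show "u \<in> {1..N} \<and> v \<in> {1..N}" using parent_maps_inside[OF p v(1)] by auto
  qed
  have "rooted_tree {1..N} 1 (edges N p)"
    unfolding rooted_tree_def using assms reach sub by (auto simp: edges_iff)
  moreover have "card (edges N p `` {v}) = 0 \<or> card (edges N p `` {v}) = 2" if "v \<in> {1..N}" for v
  proof -
    have "\<forall>u\<ge>1. card {v. p v = u} = 0 \<or> card {v. p v = u} = 2"
      using p unfolding parent_maps_def by blast
    then show ?thesis using edges_children[OF p, of v] that by auto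
  qed
  moreover have "u < v" if "(u, v) \<in> edges N p" for u v
    using that parent_maps_inside[OF p, of v] by (auto simp: edges_iff)
  ultimately show ?thesis unfolding strictly_ordered_binary_trees_def by blast
qed

lemma edges_surj:
  assumes E: "E \<in> strictly_ordered_binary_trees N"
  obtains p where "p \<in> parent_maps N" "edges N p = E"
proof -
  have sub: "E \<subseteq> {1..N} \<times> {1..N}" and root: "\<And>u. (u, 1) \<notin> E"
    and uniq: "\<And>v. v \<in> {1..N} - {1} \<Longrightarrow> \<exists>!u. (u, v) \<in> E"
    and binary: "\<And>v. v \<in> {1..N} \<Longrightarrow> card (E `` {v}) = 0 \<or> card (E `` {v}) = 2"
    and increasing: "\<And>u v. (u, v) \<in> E \<Longrightarrow> u < v"
    using E unfolding strictly_ordered_binary_trees_def rooted_tree_def by blast+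
  define p where "p v = (if v \<in> {2..N} then THE u. (u, v) \<in> E else 0)" for v
  have p: "(u, v) \<in> E \<longleftrightarrow> v \<in> {2..N} \<and> u = p v" for u v
  proof (cases "v \<in> {2..N}")
    case True
    then have "\<exists>!u. (u, v) \<in> E" using uniq[of v] by auto
    then show ?thesis unfolding p_def using True by (metis (mono_tags, lifting) theI')
  next
    case False
    moreover have "v \<noteq> 1 \<and> v \<in> {1..N}" if "(u, v) \<in> E" using that sub root by auto
    ultimately show ?thesis by auto
  qed
  have EN: "edges N p = E" using p by (auto simp: edges_iff)
  have pos: "p v \<in> {1..N} \<and> p v < v" if "v \<in> {2..N}" for v
    using p[of "p v" v] that sub increasing by blast
  have "card {v. p v = u} = 0 \<or> card {v. p v = u} = 2" if "u \<ge> 1" for u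
  proof (cases "u \<le> N")
    case True
    have "v \<in> {2..N}" if "p v = u" for v
      using that \<open>u \<ge> 1\<close> unfolding p_def by (auto split: if_splits)
    then have "{v. p v = u} = E `` {u}" by (auto simp: p Image_singleton_iff)
    then show ?thesis using binary[of u] True that by simp
  next
    case False
    then have "p v \<noteq> u" for v using pos[of v] that unfolding p_def by (auto split: if_splits)
    then show ?thesis by simp
  qed
  moreover have "p v = 0" if "v \<notin> {2..N}" for v using that unfolding p_def by auto
  ultimately have "p \<in> parent_maps N" unfolding parent_maps_def using pos by fastforce
  then show thesis using EN that by blast
qed

lemma edges_inj: "inj_on (edges N) (parent_maps N)"
proof (rule inj_onI)
  fix p q assume pq: "p \<in> parent_maps N" "q \<in> parent_maps N" "edges N p = edges N q"
  show "p = q"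
  proof
    fix v
    show "p v = q v"
    proof (cases "v \<in> {2..N}")
      case True
      then have "(p v, v) \<in> edges N q" using pq(3) by (simp add: edges_iff flip: pq(3))
      then show ?thesis by (simp add: edges_iff)
    next
      case False
      then show ?thesis using pq(1,2) parent_maps_outside by metis
    qed
  qed
qed

text \<open>When \<open>s\<close> is hung at the current end, that vertex has no smaller child, so
  \<open>s\<close> is its least child and \<open>chain_end\<close> follows the minimal chain. Steps
  are single-valued, so the childless vertex reached from 1 is unique.\<close>

lemma eoc_edges:
  assumes p: "p \<in> parent_maps N" and N: "N \<ge> 2"
  shows "eoc (edges N p) = chain_end p (Suc N)"
proof -
  let ?E = "edges N p" and ?S = "min_child_step (edges N p)"
  have reach: "(1, chain_end p s) \<in> ?S\<^sup>*" for s
  proof (induction s)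
    case (Suc s)
    show ?case
    proof (cases "p s = chain_end p s")
      case True
      let ?u = "chain_end p s"
      have u: "?u \<ge> 1" by (rule chain_end_pos[OF p])
      have ch: "?E `` {?u} = {v. p v = ?u}" by (rule edges_children[OF p u])
      have min: "Min {v. p v = ?u} = s"
      proof (rule Min_eqI)
        show "finite {v. p v = ?u}" by (rule finite_fibre[OF p u])
        show "s \<le> y" if "y \<in> {v. p v = ?u}" for y
          using that chain_end_childless[OF p, of y s] by force
        show "s \<in> {v. p v = ?u}" using True by simp
      qed
      have "(?u, s) \<in> ?S" unfolding min_child_step_def mem_Collect_eq case_prod_conv ch min
        using True by auto
      then show ?thesis using Suc True by (simp add: rtrancl_into_rtrancl)
    next
      case False
      then show ?thesis using Suc by simp
    qed
  qed simp
  let ?c = "chain_end p (Suc N)"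
  have leaf: "?E `` {?c} = {}"
    using edges_children[OF p chain_end_pos[OF p], of "Suc N"] chain_end_total[OF p N, of ?c] by auto
  have sv: "single_valued ?S" by (auto simp: single_valued_def min_child_step_def)
  have stop: "y = x" if "(x, y) \<in> ?S\<^sup>*" "?E `` {x} = {}" for x y
    using that by (metis (mono_tags, lifting) converse_rtranclE case_prodD mem_Collect_eq min_child_step_def)
  show ?thesis unfolding eoc_def
  proof (rule the_equality)
    show "(1, ?c) \<in> ?S\<^sup>* \<and> ?E `` {?c} = {}" using reach leaf by blast
    fix l assume l: "(1, l) \<in> ?S\<^sup>* \<and> ?E `` {l} = {}"
    then have "(l, ?c) \<in> ?S\<^sup>* \<or> (?c, l) \<in> ?S\<^sup>*"
      using single_valued_confluent[OF sv] reach by blast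
    then show "l = ?c" using stop[of l ?c] stop[of ?c l] l leaf by auto
  qed
qed

lemma pom_edges:
  assumes "n \<ge> 1"
  shows "pom n (edges (2*n+1) p) = p (2*n+1)"
  unfolding pom_def using assms by (simp add: edges_iff)

theorem theorem1p1:
  fixes n m k :: nat
  assumes "n \<ge> 1"
    and "1 \<le> m" and "m \<le> 2*n"
    and "1 \<le> k" and "k \<le> 2*n"
  shows "card {t \<in> strictly_ordered_binary_trees (2*n+1). eoc t = m \<and> pom n t = k} = Delta n m k"
proof -
  let ?N = "2*n+1"
  have N: "?N \<ge> 2" using assms(1) by simp
  have "{t \<in> strictly_ordered_binary_trees ?N. eoc t = m \<and> pom n t = k} =
    edges ?N ` {p \<in> parent_maps ?N. p m = chain_end p m \<and> leaf p m \<and> p ?N = k}" (is "?L = ?R")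
  proof
    show "?L \<subseteq> ?R"
    proof
      fix t assume t: "t \<in> ?L"
      then obtain p where p: "p \<in> parent_maps ?N" "edges ?N p = t" using edges_surj by blast
      then have "chain_end p (Suc ?N) = m" "p ?N = k"
        using t eoc_edges[OF p(1) N] pom_edges[OF assms(1), of p] by auto
      then show "t \<in> ?R" using p chain_end_total[OF p(1) N, of m] by blast
    qed
    show "?R \<subseteq> ?L"
    proof clarify
      fix p assume p: "p \<in> parent_maps ?N" "p m = chain_end p m" "leaf p m" "k = p ?N"
      then have "eoc (edges ?N p) = m" using eoc_edges[OF p(1) N] chain_end_total[OF p(1) N, of m] by simp
      then show "edges ?N p \<in> strictly_ordered_binary_trees ?N \<and> eoc (edges ?N p) = m \<and> pom n (edges ?N p) = p ?N"
        using edges_tree[OF p(1)] pom_edges[OF assms(1), of p] by simp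
    qed
  qed
  moreover have "card ?R = tree_count ?N m k"
    unfolding tree_count_def count_def
    by (rule card_image, rule inj_on_subset[OF edges_inj]) auto
  ultimately show ?thesis using assms unfolding Delta_eq_tree_matrix tree_matrix_def by simp
qed

end
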